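(* Let $L$ be an even lattice which is an over-lattice of another lattice $\Lambda$ (i.e. $\Lambda\subseteq L$ has finite index), and set $H=L/\Lambda\subseteq D_\Lambda$. Let $\tau\in\mathcal{H}$, let $v$ be in the common Grassmannian of $L_{\mathbb{R}}$ and $\Lambda_{\mathbb{R}}$, and let $\zeta\in L_{\mathbb{C}}=\Lambda_{\mathbb{C}}$. Then $$\uparrow^L_\Lambda\Theta_L(\tau,\zeta;v)=\frac{1}{|H|}\sum_{\alpha\in H}\sum_{\beta\in H}\hat\Theta_\Lambda\big(\tau,\zeta;\tbinom{\alpha}{\beta};v\big).$$ Moreover, if $F$ is a modular form of weight $(k,l)$ and representation $\rho_\Lambda^*$ with respect to a finite index subgroup $\Gamma\subseteq\operatorname{Mp}_2(\mathbb{Z})$, then $$\Phi_{L,v}^{\downarrow^{L(-1)}_{\Lambda(-1)}F}(\tau,\zeta)=\frac{1}{|H|}\sum_{\alpha\in H}\sum_{\beta\in H}\big\langle\hat\Theta_\Lambda\big(\tau,\zeta;\tbinom{\alpha}{\beta};v\big),F(\tau)\big\rangle_\Lambda .$$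
   Context: Lattices. An even lattice is a free $\mathbb{Z}$-module $L$ of finite rank with a non-degenerate symmetric bilinear form $(\cdot,\cdot):L\times L\to\mathbb{Z}$ such that $\lambda^2:=(\lambda,\lambda)$ is even for every $\lambda\in L$. Put $L_{\mathbb{R}}=L\otimes\mathbb{R}$, $L_{\mathbb{C}}=L\otimes\mathbb{C}$; the pairing and $\lambda\mapsto\lambda^2$ are extended bilinearly (no complex conjugation). The signature $(b_+,b_-)$ of $L$ is that of $L_{\mathbb{R}}$. The dual lattice is $L^*=\{\lambda\in L_{\mathbb{R}}:(\lambda,L)\subseteq\mathbb{Z}\}\supseteq L$, and $D_L=L^*/L$ is a finite group. $\mathbb{C}[D_L]$ has basis $\{\mathfrak{e}_\gamma\}_{\gamma\in D_L}$. Write $\mathbf{e}(w)=e^{2\pi iw}$ and $\mathcal{H}=\{\tau=x+iy\in\mathbb{C}:y>0\}$. $\operatorname{Gr}(L_{\mathbb{R}})$ is the set of orthogonal decompositions $v$: $L_{\mathbb{R}}=v_+\oplus v_-$ with $v_+$ positive definite and $v_-$ negative definite; $\lambda_{v_\pm}$ is the orthogonal projection of $\lambda$ onto $v_\pm$. Theta functions. For an even lattice $L$, $\alpha,\beta\in L_{\mathbb{R}}$ and $\zeta\in L_{\mathbb{C}}$, $$\Theta_L\big(\tau,\zeta;\tbinom{\alpha}{\beta};v\big)=\sum_{\lambda\in L^*}\mathbf{e}\Big(\tau\tfrac{(\lambda+\beta)_{v_+}^2}{2}+\overline\tau\tfrac{(\lambda+\beta)_{v_-}^2}{2}+(\lambda+\beta,\zeta)-\big(\lambda+\tfrac\beta2,\alpha\big)\Big)\mathfrak{e}_{\lambda+L},$$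 $\Theta_L(\tau,\zeta;v)=\Theta_L\big(\tau,\zeta;\tbinom{0}{0};v\big)$, and $\hat\Theta_L\big(\tau,\zeta;\tbinom{\alpha}{\beta};v\big)=\mathbf{e}\big(-\tfrac{(\alpha,\beta)}{2}\big)\Theta_L\big(\tau,\zeta;\tbinom{\alpha}{\beta};v\big)$. The function $\hat\Theta_L$ satisfies $\hat\Theta_L\big(\tau,\zeta;\tbinom{\alpha+\nu}{\beta+\sigma};v\big)=\mathbf{e}(-(\beta,\nu))\hat\Theta_L\big(\tau,\zeta;\tbinom{\alpha}{\beta};v\big)$ for $\nu,\sigma\in L$, so for $\beta\in L^*$ it depends only on $\alpha$ and $\beta$ modulo $L$; in particular $\hat\Theta_\Lambda\big(\tau,\zeta;\tbinom{\alpha}{\beta};v\big)$ is well defined for $\alpha,\beta\in H=L/\Lambda\subseteq D_\Lambda=\Lambda^*/\Lambda$ by choosing any lifts. Metaplectic group. For $A=\begin{pmatrix}a&b\\c&d\end{pmatrix}\in\operatorname{SL}_2(\mathbb{R})$ put $A\tau=\frac{a\tau+b}{c\tau+d}$, $j(A,\tau)=c\tau+d$. $\operatorname{Mp}_2(\mathbb{R})$ is the group of pairs $(A,\phi)$ with $A\in\operatorname{SL}_2(\mathbb{R})$, $\phi:\mathcal{H}\to\mathbb{C}$ holomorphic, $\phi^2(\tau)=j(A,\tau)$, with product $(A,\phi)(B,\psi)=(AB,(\phi\circ B)\psi)$; $\operatorname{Mp}_2(\mathbb{Z})$ is the inverse image of $\operatorname{SL}_2(\mathbb{Z})$. It is generated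 by $T=\big(\begin{pmatrix}1&1\\0&1\end{pmatrix},1\big)$ and $S=\big(\begin{pmatrix}0&-1\\1&0\end{pmatrix},\sqrt{\tau}\big)$ with $\sqrt\tau\in\mathcal{H}$. The Weil representation $\rho_L$ of $\operatorname{Mp}_2(\mathbb{Z})$ on $\mathbb{C}[D_L]$ is given by $$\rho_L(T)\mathfrak{e}_\gamma=\mathbf{e}(\tfrac{\gamma^2}{2})\mathfrak{e}_\gamma,\qquad \rho_L(S)\mathfrak{e}_\gamma=\frac{\mathbf{e}\big(\frac{b_--b_+}{8}\big)}{\sqrt{|D_L|}}\sum_{\delta\in D_L}\mathbf{e}(-(\gamma,\delta))\mathfrak{e}_\delta .$$ $L(-1)$ is $L$ with the forms negated; $\mathbb{C}[D_{L(-1)}]$ has basis $\{\mathfrak{e}_\gamma^*\}_{\gamma\in D_L}$, regarded as dual to $\{\mathfrak{e}_\gamma\}$ via the bilinear pairing $\langle\cdot,\cdot\rangle_L:\mathbb{C}[D_L]\times\mathbb{C}[D_{L(-1)}]\to\mathbb{C}$, $\langle\mathfrak{e}_\gamma,\mathfrak{e}_\delta^*\rangle_L=\delta_{\gamma,\delta}$. $\rho_L^*=\rho_{L(-1)}$ is the dual representation: $\langle\rho_L(A,\phi)U,\rho_L^*(A,\phi)V\rangle_L=\langle U,V\rangle_L$. Modular forms. For $k,l\in\frac12\mathbb{Z}$, a modular form of weight $(k,l)$ and representation $\rho_L^*$ with respect to $\Gamma$ is a smooth $F:\mathcal{H}\to\mathbb{C}[D_{L(-1)}]$ with $F(A\tau)=\phi(\tau)^{2k}\overline{\phi(\tau)}^{2l}\rho_L^*(A,\phi)F(\tau)$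 for all $\tau\in\mathcal{H}$, $(A,\phi)\in\Gamma$, and with at most linear exponential growth at the cusps (for every $A\in\operatorname{SL}_2(\mathbb{Z})$ there is $C$ with $F(A\tau)=O(e^{Cy})$ as $y\to\infty$, uniformly for $x$ in bounded sets). For such $F$, $\Phi_{L,v}^F(\tau,\zeta)=\langle\Theta_L(\tau,\zeta;v),F(\tau)\rangle_L$. Arrow operators. $H=L/\Lambda$ is an isotropic subgroup of $D_\Lambda$, $H^\perp=L^*/\Lambda\subseteq D_\Lambda$ and $D_L=H^\perp/H$. $\uparrow^L_\Lambda:\mathbb{C}[D_L]\to\mathbb{C}[D_\Lambda]$ is the linear map $\mathfrak{e}_\gamma\mapsto\sum_{\delta\in H^\perp,\ \delta+H=\gamma}\mathfrak{e}_\delta$. $\downarrow^{L(-1)}_{\Lambda(-1)}:\mathbb{C}[D_{\Lambda(-1)}]\to\mathbb{C}[D_{L(-1)}]$ is the linear map with $\mathfrak{e}_\delta^*\mapsto\mathfrak{e}_{\delta+H}^*$ if $\delta\in H^\perp$ and $\mathfrak{e}_\delta^*\mapsto0$ otherwise; it takes modular forms with representation $\rho_\Lambda^*$ to modular forms of the same weight with representation $\rho_L^*$. *)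

theory Defs
  imports "HOL-Analysis.Analysis" "HOL-Library.Set_Algebras" "HOL-Algebra.Coset"
begin

section \<open>Even lattices\<close>

text \<open>
  The ambient type \<^typ>\<open>'a\<close> plays the role of \<open>L\<^sub>\<real>\<close>: a lattice is the integral span of a finite
  real basis of \<^typ>\<open>'a\<close>. The bilinear form on \<open>L\<^sub>\<real>\<close> is a separate argument \<open>B\<close>, so that
  \<open>L(-1)\<close> is the same set \<open>L\<close> taken with \<open>neg_form B\<close>, and an over-lattice shares the form.
\<close>

definition full_lattice :: "'a::real_vector set \<Rightarrow> bool" where
  "full_lattice L \<longleftrightarrow>
     (\<exists>b. finite b \<and> independent b \<and> span b = UNIV \<and>
          L = {\<Sum>x\<in>b. of_int (c x) *\<^sub>R x | c. True})"

definition even_lattice :: "('a::real_vector \<Rightarrow> 'a \<Rightarrow> real) \<Rightarrow> 'a set \<Rightarrow> bool" where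
  "even_lattice B L \<longleftrightarrow>
     full_lattice L \<and> bilinear B \<and> (\<forall>x y. B x y = B y x) \<and>
     (\<forall>x\<in>L. (\<forall>y\<in>L. B x y = 0) \<longrightarrow> x = 0) \<and>
     (\<forall>x\<in>L. \<forall>y\<in>L. B x y \<in> \<int>) \<and>
     (\<forall>x\<in>L. \<exists>m::int. B x x = 2 * of_int m)"

definition neg_form :: "('a \<Rightarrow> 'a \<Rightarrow> real) \<Rightarrow> 'a \<Rightarrow> 'a \<Rightarrow> real" where
  "neg_form B x y = - B x y"

definition dual_lattice :: "('a::real_vector \<Rightarrow> 'a \<Rightarrow> real) \<Rightarrow> 'a set \<Rightarrow> 'a set" where
  "dual_lattice B L = {x. \<forall>y\<in>L. B x y \<in> \<int>}"

definition quot :: "'a::real_vector set \<Rightarrow> 'a set \<Rightarrow> 'a set set" where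
  "quot M L = (\<lambda>x. x +o L) ` M"

definition disc_group :: "('a::real_vector \<Rightarrow> 'a \<Rightarrow> real) \<Rightarrow> 'a set \<Rightarrow> 'a set set" where
  "disc_group B L = quot (dual_lattice B L) L"

definition coset_rep :: "'a set \<Rightarrow> 'a" where
  "coset_rep \<gamma> = (SOME x. x \<in> \<gamma>)"

definition pos_index :: "('a::real_vector \<Rightarrow> 'a \<Rightarrow> real) \<Rightarrow> nat" where
  "pos_index B = Max (dim ` {U. subspace U \<and> (\<forall>x\<in>U. x \<noteq> 0 \<longrightarrow> 0 < B x x)})"

definition neg_index :: "('a::real_vector \<Rightarrow> 'a \<Rightarrow> real) \<Rightarrow> nat" where
  "neg_index B = pos_index (neg_form B)"

text \<open>A point of the Grassmannian is the pair \<open>(v\<^sub>+, v\<^sub>-)\<close>.\<close>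

definition Grassmannian :: "('a::real_vector \<Rightarrow> 'a \<Rightarrow> real) \<Rightarrow> ('a set \<times> 'a set) set" where
  "Grassmannian B = {(P, N). subspace P \<and> subspace N \<and> P + N = UNIV \<and> P \<inter> N = {0} \<and>
     (\<forall>x\<in>P. \<forall>y\<in>N. B x y = 0) \<and>
     (\<forall>x\<in>P. x \<noteq> 0 \<longrightarrow> 0 < B x x) \<and> (\<forall>x\<in>N. x \<noteq> 0 \<longrightarrow> B x x < 0)}"

definition proj_plus :: "'a::real_vector set \<times> 'a set \<Rightarrow> 'a \<Rightarrow> 'a" where
  "proj_plus v x = (THE p. p \<in> fst v \<and> x - p \<in> snd v)"

definition proj_minus :: "'a::real_vector set \<times> 'a set \<Rightarrow> 'a \<Rightarrow> 'a" where
  "proj_minus v x = (THE p. p \<in> snd v \<and> x - p \<in> fst v)"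

text \<open>
  An element \<open>\<zeta> = \<zeta>\<^sub>1 + i \<zeta>\<^sub>2\<close> of \<open>L\<^sub>\<complex>\<close> is the pair \<open>(\<zeta>\<^sub>1, \<zeta>\<^sub>2)\<close>; the pairing is extended
  bilinearly.
\<close>

definition pair_complex :: "('a \<Rightarrow> 'a \<Rightarrow> real) \<Rightarrow> 'a \<Rightarrow> 'a \<times> 'a \<Rightarrow> complex" where
  "pair_complex B x \<zeta> = of_real (B x (fst \<zeta>)) + \<i> * of_real (B x (snd \<zeta>))"


section \<open>The spaces \<open>\<complex>[D]\<close> and the arrow operators\<close>

definition group_space :: "'d set \<Rightarrow> ('d \<Rightarrow> complex) set" where
  "group_space D = {U. \<forall>\<gamma>. \<gamma> \<notin> D \<longrightarrow> U \<gamma> = 0}"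

definition basis_vec :: "'d \<Rightarrow> 'd \<Rightarrow> complex" where
  "basis_vec \<gamma> \<delta> = (if \<delta> = \<gamma> then 1 else 0)"

text \<open>
  The pairing of \<open>\<complex>[D\<^sub>L]\<close> with \<open>\<complex>[D\<^bsub>L(-1)\<^esub>]\<close>; both are indexed by the same set of cosets.
\<close>

definition disc_pairing :: "'d set \<Rightarrow> ('d \<Rightarrow> complex) \<Rightarrow> ('d \<Rightarrow> complex) \<Rightarrow> complex" where
  "disc_pairing D U V = (\<Sum>\<gamma>\<in>D. U \<gamma> * V \<gamma>)"

text \<open>
  For \<open>\<Lambda> \<subseteq> L\<close> the group \<open>H\<^sup>\<bottom>\<close> is \<open>L\<^sup>*/\<Lambda>\<close>, and under \<open>D\<^sub>L = H\<^sup>\<bottom>/H\<close> the class of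
  \<open>\<delta> = x + \<Lambda>\<close> is \<open>x + L\<close>, which is the setwise sum \<open>\<delta> + L\<close>.
\<close>

definition arrow_up ::
  "('a::real_vector \<Rightarrow> 'a \<Rightarrow> real) \<Rightarrow> 'a set \<Rightarrow> 'a set \<Rightarrow> ('a set \<Rightarrow> complex) \<Rightarrow> 'a set \<Rightarrow> complex" where
  "arrow_up B L \<Lambda> U = (\<lambda>\<epsilon>. \<Sum>\<gamma>\<in>disc_group B L.
     U \<gamma> * (\<Sum>\<delta> | \<delta> \<in> quot (dual_lattice B L) \<Lambda> \<and> \<delta> + L = \<gamma>. basis_vec \<delta> \<epsilon>))"

definition arrow_down ::
  "('a::real_vector \<Rightarrow> 'a \<Rightarrow> real) \<Rightarrow> 'a set \<Rightarrow> 'a set \<Rightarrow> ('a set \<Rightarrow> complex) \<Rightarrow> 'a set \<Rightarrow> complex" where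
  "arrow_down B L \<Lambda> V = (\<lambda>\<gamma>. \<Sum>\<delta>\<in>disc_group B \<Lambda>.
     V \<delta> * (if \<delta> \<in> quot (dual_lattice B L) \<Lambda> then basis_vec (\<delta> + L) \<gamma> else 0))"


section \<open>Theta functions\<close>

definition ee :: "complex \<Rightarrow> complex" where
  "ee w = exp (2 * of_real pi * \<i> * w)"

definition uhp :: "complex set" where
  "uhp = {\<tau>. 0 < Im \<tau>}"

definition Theta ::
  "('a::real_vector \<Rightarrow> 'a \<Rightarrow> real) \<Rightarrow> 'a set \<Rightarrow> complex \<Rightarrow> 'a \<times> 'a \<Rightarrow> 'a \<Rightarrow> 'a \<Rightarrow> 'a set \<times> 'a set
    \<Rightarrow> 'a set \<Rightarrow> complex" where
  "Theta B L \<tau> \<zeta> \<alpha> \<beta> v = (\<lambda>\<gamma>. \<Sum>\<^sub>\<infinity>x\<in>dual_lattice B L.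
     ee (\<tau> * of_real (B (proj_plus v (x + \<beta>)) (proj_plus v (x + \<beta>)) / 2)
         + cnj \<tau> * of_real (B (proj_minus v (x + \<beta>)) (proj_minus v (x + \<beta>)) / 2)
         + pair_complex B (x + \<beta>) \<zeta>
         - of_real (B (x + (1 / 2) *\<^sub>R \<beta>) \<alpha>))
     * basis_vec (x +o L) \<gamma>)"

definition hat_Theta ::
  "('a::real_vector \<Rightarrow> 'a \<Rightarrow> real) \<Rightarrow> 'a set \<Rightarrow> complex \<Rightarrow> 'a \<times> 'a \<Rightarrow> 'a \<Rightarrow> 'a \<Rightarrow> 'a set \<times> 'a set
    \<Rightarrow> 'a set \<Rightarrow> complex" where
  "hat_Theta B L \<tau> \<zeta> \<alpha> \<beta> v = (\<lambda>\<gamma>. ee (- of_real (B \<alpha> \<beta> / 2)) * Theta B L \<tau> \<zeta> \<alpha> \<beta> v \<gamma>)"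

text \<open>
  \<open>hat_Theta\<close> with characteristics in \<open>D\<^sub>L\<close>, by choice of lifts; see
  \<open>hat_Theta_class_eq\<close> below for the independence of the choice.
\<close>

definition hat_Theta_class ::
  "('a::real_vector \<Rightarrow> 'a \<Rightarrow> real) \<Rightarrow> 'a set \<Rightarrow> complex \<Rightarrow> 'a \<times> 'a \<Rightarrow> 'a set \<Rightarrow> 'a set \<Rightarrow> 'a set \<times> 'a set
    \<Rightarrow> 'a set \<Rightarrow> complex" where
  "hat_Theta_class B L \<tau> \<zeta> \<alpha> \<beta> v = hat_Theta B L \<tau> \<zeta> (coset_rep \<alpha>) (coset_rep \<beta>) v"

definition Phi ::
  "('a::real_vector \<Rightarrow> 'a \<Rightarrow> real) \<Rightarrow> 'a set \<Rightarrow> 'a set \<times> 'a set \<Rightarrow> (complex \<Rightarrow> 'a set \<Rightarrow> complex)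
    \<Rightarrow> complex \<Rightarrow> 'a \<times> 'a \<Rightarrow> complex" where
  "Phi B L v F \<tau> \<zeta> = disc_pairing (disc_group B L) (Theta B L \<tau> \<zeta> 0 0 v) (F \<tau>)"


section \<open>The metaplectic group\<close>

definition lin_frac :: "real^2^2 \<Rightarrow> complex \<Rightarrow> complex" where
  "lin_frac A \<tau> = (of_real (A$1$1) * \<tau> + of_real (A$1$2)) / (of_real (A$2$1) * \<tau> + of_real (A$2$2))"

definition aut_factor :: "real^2^2 \<Rightarrow> complex \<Rightarrow> complex" where
  "aut_factor A \<tau> = of_real (A$2$1) * \<tau> + of_real (A$2$2)"

text \<open>
  The functions \<open>\<phi>\<close> live on the upper half-plane only; they are made \<^const>\<open>undefined\<close>
  elsewhere so that equality in the group is equality of functions on the half-plane.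
\<close>

definition Mp2R :: "((real^2^2) \<times> (complex \<Rightarrow> complex)) monoid" where
  "Mp2R = \<lparr>carrier = {(A, \<phi>). det A = 1 \<and> \<phi> \<in> extensional uhp \<and> \<phi> holomorphic_on uhp \<and>
                         (\<forall>\<tau>\<in>uhp. (\<phi> \<tau>)\<^sup>2 = aut_factor A \<tau>)},
     mult = (\<lambda>(A, \<phi>) (B, \<psi>). (A ** B, \<lambda>\<tau>\<in>uhp. \<phi> (lin_frac B \<tau>) * \<psi> \<tau>)),
     one = (mat 1, \<lambda>\<tau>\<in>uhp. 1)\<rparr>"

definition SL2Z :: "(real^2^2) set" where
  "SL2Z = {A. det A = 1 \<and> (\<forall>i j. A$i$j \<in> \<int>)}"

definition Mp2Z :: "((real^2^2) \<times> (complex \<Rightarrow> complex)) monoid" where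
  "Mp2Z = Mp2R\<lparr>carrier := {g \<in> carrier Mp2R. fst g \<in> SL2Z}\<rparr>"

definition mp_T :: "(real^2^2) \<times> (complex \<Rightarrow> complex)" where
  "mp_T = (vector [vector [1, 1], vector [0, 1]], \<lambda>\<tau>\<in>uhp. 1)"

definition mp_S :: "(real^2^2) \<times> (complex \<Rightarrow> complex)" where
  "mp_S = (vector [vector [0, -1], vector [1, 0]], \<lambda>\<tau>\<in>uhp. csqrt \<tau>)"

text \<open>
  \<open>\<rho>\<close> is the Weil representation of \<open>L\<close>: the representation of \<open>Mp\<^sub>2(\<int>)\<close> on \<open>\<complex>[D\<^sub>L]\<close>
  with the prescribed values on the generators \<open>T\<close> and \<open>S\<close>.
\<close>

definition weil_representation ::
  "('a::real_vector \<Rightarrow> 'a \<Rightarrow> real) \<Rightarrow> 'a set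
    \<Rightarrow> ((real^2^2) \<times> (complex \<Rightarrow> complex) \<Rightarrow> ('a set \<Rightarrow> complex) \<Rightarrow> 'a set \<Rightarrow> complex) \<Rightarrow> bool" where
  "weil_representation B L \<rho> \<longleftrightarrow>
     (\<forall>g\<in>carrier Mp2Z. \<forall>U\<in>group_space (disc_group B L). \<rho> g U \<in> group_space (disc_group B L)) \<and>
     (\<forall>g\<in>carrier Mp2Z. \<forall>U\<in>group_space (disc_group B L). \<forall>V\<in>group_space (disc_group B L). \<forall>a b.
        \<rho> g (\<lambda>\<gamma>. a * U \<gamma> + b * V \<gamma>) = (\<lambda>\<gamma>. a * \<rho> g U \<gamma> + b * \<rho> g V \<gamma>)) \<and>
     (\<forall>U\<in>group_space (disc_group B L). \<rho> \<one>\<^bsub>Mp2Z\<^esub> U = U) \<and>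
     (\<forall>g\<in>carrier Mp2Z. \<forall>h\<in>carrier Mp2Z. \<forall>U\<in>group_space (disc_group B L).
        \<rho> (g \<otimes>\<^bsub>Mp2Z\<^esub> h) U = \<rho> g (\<rho> h U)) \<and>
     (\<forall>\<gamma>\<in>disc_group B L. \<rho> mp_T (basis_vec \<gamma>) =
        (\<lambda>\<epsilon>. ee (of_real (B (coset_rep \<gamma>) (coset_rep \<gamma>) / 2)) * basis_vec \<gamma> \<epsilon>)) \<and>
     (\<forall>\<gamma>\<in>disc_group B L. \<rho> mp_S (basis_vec \<gamma>) =
        (\<lambda>\<epsilon>. ee (of_real ((real (neg_index B) - real (pos_index B)) / 8))
              / of_real (sqrt (real (card (disc_group B L))))
              * (\<Sum>\<delta>\<in>disc_group B L.
                   ee (- of_real (B (coset_rep \<gamma>) (coset_rep \<delta>))) * basis_vec \<delta> \<epsilon>)))"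


section \<open>Modular forms\<close>

text \<open>Real smoothness on an open set, by iterated directional derivatives.\<close>

primrec Ck_on :: "nat \<Rightarrow> 'a::real_normed_vector set \<Rightarrow> ('a \<Rightarrow> 'b::real_normed_vector) \<Rightarrow> bool" where
  "Ck_on 0 S f \<longleftrightarrow> continuous_on S f"
| "Ck_on (Suc n) S f \<longleftrightarrow> (\<forall>x\<in>S. f differentiable (at x)) \<and>
     (\<forall>w. Ck_on n S (\<lambda>x. frechet_derivative f (at x) w))"

definition smooth_on :: "'a::real_normed_vector set \<Rightarrow> ('a \<Rightarrow> 'b::real_normed_vector) \<Rightarrow> bool" where
  "smooth_on S f \<longleftrightarrow> (\<forall>n. Ck_on n S f)"

text \<open>
  Modular forms of weight \<open>(k, l)\<close>, with values in \<open>\<complex>[D]\<close>, for the representation \<open>\<rho>\<close> and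
  the group \<open>\<Gamma>\<close>. Since \<open>2k\<close> and \<open>2l\<close> are integers, \<open>\<lfloor>2k\<rfloor>\<close> and \<open>\<lfloor>2l\<rfloor>\<close> are just \<open>2k\<close> and
  \<open>2l\<close> as elements of \<^typ>\<open>int\<close>.
\<close>

definition modular_form ::
  "'d set \<Rightarrow> ((real^2^2) \<times> (complex \<Rightarrow> complex) \<Rightarrow> ('d \<Rightarrow> complex) \<Rightarrow> 'd \<Rightarrow> complex)
    \<Rightarrow> real \<Rightarrow> real \<Rightarrow> ((real^2^2) \<times> (complex \<Rightarrow> complex)) set \<Rightarrow> (complex \<Rightarrow> 'd \<Rightarrow> complex) \<Rightarrow> bool" where
  "modular_form D \<rho> k l \<Gamma> F \<longleftrightarrow>
     2 * k \<in> \<int> \<and> 2 * l \<in> \<int> \<and>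
     (\<forall>\<tau>\<in>uhp. F \<tau> \<in> group_space D) \<and>
     (\<forall>\<gamma>\<in>D. smooth_on uhp (\<lambda>\<tau>. F \<tau> \<gamma>)) \<and>
     (\<forall>(A, \<phi>)\<in>\<Gamma>. \<forall>\<tau>\<in>uhp. F (lin_frac A \<tau>) =
        (\<lambda>\<gamma>. \<phi> \<tau> powi \<lfloor>2 * k\<rfloor> * cnj (\<phi> \<tau>) powi \<lfloor>2 * l\<rfloor> * \<rho> (A, \<phi>) (F \<tau>) \<gamma>)) \<and>
     (\<forall>A\<in>SL2Z. \<exists>C. \<forall>R. \<exists>K. \<exists>Y>0. \<forall>x y. \<bar>x\<bar> \<le> R \<longrightarrow> Y \<le> y \<longrightarrow>
        (\<forall>\<gamma>\<in>D. norm (F (lin_frac A (Complex x y)) \<gamma>) \<le> K * exp (C * y)))"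


section \<open>Consistency of the definitions\<close>

lemma ee_add: "ee (a + b) = ee a * ee b"
  by (simp add: ee_def algebra_simps exp_add)

lemma ee_Ints: "r \<in> \<int> \<Longrightarrow> ee (of_real r) = 1"
  unfolding ee_def exp_eq_1 by (elim Ints_cases) (auto simp: mult_ac)

lemma full_lattice_closed:
  assumes "full_lattice L"
  shows "0 \<in> L" "x \<in> L \<Longrightarrow> y \<in> L \<Longrightarrow> x + y \<in> L" "x \<in> L \<Longrightarrow> - x \<in> L"
proof -
  from assms obtain b where L: "L = {\<Sum>x\<in>b. of_int (c x) *\<^sub>R x | c. True}"
    unfolding full_lattice_def by blast
  show "0 \<in> L" unfolding L by (rule CollectI, rule exI[of _ "\<lambda>_. 0"]) simp
  show "x + y \<in> L" if "x \<in> L" "y \<in> L"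
  proof -
    from that obtain c d where "x = (\<Sum>x\<in>b. of_int (c x) *\<^sub>R x)" "y = (\<Sum>x\<in>b. of_int (d x) *\<^sub>R x)"
      unfolding L by blast
    hence "x + y = (\<Sum>x\<in>b. of_int (c x + d x) *\<^sub>R x)"
      by (simp add: sum.distrib scaleR_left_distrib)
    thus ?thesis unfolding L by (intro CollectI exI[of _ "\<lambda>x. c x + d x"]) simp
  qed
  show "- x \<in> L" if "x \<in> L"
  proof -
    from that obtain c where "x = (\<Sum>x\<in>b. of_int (c x) *\<^sub>R x)" unfolding L by blast
    hence "- x = (\<Sum>x\<in>b. of_int (- c x) *\<^sub>R x)" by (simp add: sum_negf)
    thus ?thesis unfolding L by (intro CollectI exI[of _ "\<lambda>x. - c x"]) simp
  qed
qed

lemma hat_Theta_shift: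
  assumes L: "even_lattice B L" and \<nu>: "\<nu> \<in> L" and \<sigma>: "\<sigma> \<in> L"
  shows "hat_Theta B L \<tau> \<zeta> (\<alpha> + \<nu>) (\<beta> + \<sigma>) v =
         (\<lambda>\<gamma>. ee (- of_real (B \<beta> \<nu>)) * hat_Theta B L \<tau> \<zeta> \<alpha> \<beta> v \<gamma>)"
proof
  fix \<gamma>
  have bil: "bilinear B" and sym: "\<And>x y. B x y = B y x"
    and int: "\<And>x y. x \<in> L \<Longrightarrow> y \<in> L \<Longrightarrow> B x y \<in> \<int>" and fl: "full_lattice L"
    using L by (auto simp: even_lattice_def)
  note cl = full_lattice_closed[OF fl]
  define E where "E = (\<lambda>w. ee (\<tau> * of_real (B (proj_plus v w) (proj_plus v w) / 2)
         + cnj \<tau> * of_real (B (proj_minus v w) (proj_minus v w) / 2) + pair_complex B w \<zeta>))"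
  have hT: "hat_Theta B L \<tau> \<zeta> a b v \<gamma> =
      (\<Sum>\<^sub>\<infinity>x\<in>dual_lattice B L. E (x + b) * ee (- of_real (B (x + b) a)) * basis_vec (x +o L) \<gamma>)" for a b
    unfolding hat_Theta_def Theta_def infsum_cmult_right'[symmetric]
  proof (rule infsum_cong)
    fix x
    have *: "- of_real (B (x + b) a) = - of_real (B a b / 2) - (of_real (B (x + (1 / 2) *\<^sub>R b) a) :: complex)"
      by (simp add: bilinear_ladd[OF bil] bilinear_lmul[OF bil] sym[of a b] field_simps)
    show "ee (- of_real (B a b / 2)) *
         (ee (\<tau> * of_real (B (proj_plus v (x + b)) (proj_plus v (x + b)) / 2) +
              cnj \<tau> * of_real (B (proj_minus v (x + b)) (proj_minus v (x + b)) / 2) +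
              pair_complex B (x + b) \<zeta> - of_real (B (x + (1 / 2) *\<^sub>R b) a)) *
          basis_vec (x +o L) \<gamma>) =
         E (x + b) * ee (- of_real (B (x + b) a)) * basis_vec (x +o L) \<gamma>"
      unfolding * E_def diff_conv_add_uminus ee_add by (simp only: mult_ac)
  qed
  have L_dual: "L \<subseteq> dual_lattice B L" using int by (auto simp: dual_lattice_def)
  have add_dual: "x + y \<in> dual_lattice B L" if "x \<in> dual_lattice B L" "y \<in> dual_lattice B L" for x y
    using that by (auto simp: dual_lattice_def bilinear_ladd[OF bil])
  have coset: "(x + y) +o L = x +o L" if "y \<in> L" for x y
  proof (intro Set.set_eqI iffI)
    fix z assume "z \<in> (x + y) +o L"
    then obtain u where "u \<in> L" "z = x + (y + u)" by (auto simp: elt_set_plus_def add.assoc)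
    thus "z \<in> x +o L" using cl(2)[OF that, of u] by (auto simp: elt_set_plus_def)
  next
    fix z assume "z \<in> x +o L"
    then obtain u where u: "u \<in> L" "z = x + u" by (auto simp: elt_set_plus_def)
    hence "z = (x + y) + (- y + u)" by simp
    thus "z \<in> (x + y) +o L" using cl(2)[OF cl(3)[OF that] u(1)] unfolding elt_set_plus_def by blast
  qed
  have "hat_Theta B L \<tau> \<zeta> (\<alpha> + \<nu>) (\<beta> + \<sigma>) v \<gamma> =
      (\<Sum>\<^sub>\<infinity>x\<in>dual_lattice B L. E (x + (\<beta> + \<sigma>)) * ee (- of_real (B (x + (\<beta> + \<sigma>)) (\<alpha> + \<nu>))) * basis_vec (x +o L) \<gamma>)"
    by (rule hT)
  also have "\<dots> = (\<Sum>\<^sub>\<infinity>x\<in>dual_lattice B L. ee (- of_real (B \<beta> \<nu>)) *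
      (E (x + \<beta>) * ee (- of_real (B (x + \<beta>) \<alpha>)) * basis_vec (x +o L) \<gamma>))"
  proof (rule infsum_reindex_bij_witness[where j = "\<lambda>x. x + \<sigma>" and i = "\<lambda>x. x + (- \<sigma>)"])
    fix x assume x: "x \<in> dual_lattice B L"
    show "x + \<sigma> \<in> dual_lattice B L" "x + - \<sigma> \<in> dual_lattice B L"
      using add_dual[OF x] \<sigma> cl(3)[OF \<sigma>] L_dual by blast+
    have "ee (- of_real (B (x + (\<beta> + \<sigma>)) (\<alpha> + \<nu>))) =
       ee (of_real (- B (x + \<sigma>) \<nu>)) * (ee (- of_real (B \<beta> \<nu>)) * ee (- of_real (B ((x + \<sigma>) + \<beta>) \<alpha>)))"
      unfolding ee_add[symmetric]
      by (rule arg_cong[of _ _ ee])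
         (simp add: bilinear_ladd[OF bil] bilinear_radd[OF bil] algebra_simps)
    also have "ee (of_real (- B (x + \<sigma>) \<nu>)) = 1"
      using x \<sigma> \<nu> L_dual add_dual by (intro ee_Ints Ints_minus) (force simp: dual_lattice_def)
    finally show "ee (- of_real (B \<beta> \<nu>)) *
      (E ((x + \<sigma>) + \<beta>) * ee (- of_real (B ((x + \<sigma>) + \<beta>) \<alpha>)) * basis_vec ((x + \<sigma>) +o L) \<gamma>) =
      E (x + (\<beta> + \<sigma>)) * ee (- of_real (B (x + (\<beta> + \<sigma>)) (\<alpha> + \<nu>))) * basis_vec (x +o L) \<gamma>"
      using coset[OF \<sigma>, of x] by (simp add: add_ac)
  qed auto
  also have "\<dots> = ee (- of_real (B \<beta> \<nu>)) * hat_Theta B L \<tau> \<zeta> \<alpha> \<beta> v \<gamma>"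
    by (simp only: hT infsum_cmult_right')
  finally show "hat_Theta B L \<tau> \<zeta> (\<alpha> + \<nu>) (\<beta> + \<sigma>) v \<gamma> =
     ee (- of_real (B \<beta> \<nu>)) * hat_Theta B L \<tau> \<zeta> \<alpha> \<beta> v \<gamma>" .
qed

lemma hat_Theta_class_eq:
  assumes L: "even_lattice B L" and \<beta>: "\<beta> \<in> dual_lattice B L"
  shows "hat_Theta_class B L \<tau> \<zeta> (\<alpha> +o L) (\<beta> +o L) v = hat_Theta B L \<tau> \<zeta> \<alpha> \<beta> v"
proof -
  have "full_lattice L" using L by (simp add: even_lattice_def)
  hence "0 \<in> L" by (rule full_lattice_closed(1))
  hence "x \<in> x +o L" for x by (force simp: elt_set_plus_def)
  hence rep: "coset_rep (x +o L) \<in> x +o L" for x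
    unfolding coset_rep_def by (rule someI)
  obtain \<nu> \<sigma> where "\<nu> \<in> L" "\<sigma> \<in> L"
    "coset_rep (\<alpha> +o L) = \<alpha> + \<nu>" "coset_rep (\<beta> +o L) = \<beta> + \<sigma>"
    using rep[of \<alpha>] rep[of \<beta>] by (auto simp: elt_set_plus_def)
  moreover from this have "ee (- of_real (B \<beta> \<nu>)) = 1"
    using \<beta> ee_Ints[of "- B \<beta> \<nu>"] by (auto simp: dual_lattice_def)
  ultimately show ?thesis
    by (simp add: hat_Theta_class_def hat_Theta_shift[OF L])
qed

lemma aut_factor_nonzero:
  assumes "det A = 1" "\<tau> \<in> uhp"
  shows "aut_factor A \<tau> \<noteq> 0"
proof
  assume 0: "aut_factor A \<tau> = 0"
  hence "A$2$1 * Im \<tau> = 0" "A$2$1 * Re \<tau> + A$2$2 = 0"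
    by (auto simp: aut_factor_def complex_eq_iff)
  hence "A$2$1 = 0" "A$2$2 = 0" using assms(2) by (auto simp: uhp_def)
  thus False using assms(1) by (simp add: det_2)
qed

lemma lin_frac_uhp:
  assumes "det A = 1" "\<tau> \<in> uhp"
  shows "lin_frac A \<tau> \<in> uhp"
proof -
  have nz: "aut_factor A \<tau> \<noteq> 0" by (rule aut_factor_nonzero[OF assms])
  have "Im (lin_frac A \<tau>) = (A$1$1 * A$2$2 - A$1$2 * A$2$1) * Im \<tau> / (norm (aut_factor A \<tau>))\<^sup>2"
    unfolding lin_frac_def aut_factor_def Im_divide cmod_power2
    by (simp add: algebra_simps)
  also have "A$1$1 * A$2$2 - A$1$2 * A$2$1 = 1" using assms(1) by (simp add: det_2)
  finally show ?thesis using nz assms(2) by (simp add: uhp_def)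
qed

lemma aut_factor_mult:
  assumes "det B = 1" "\<tau> \<in> uhp"
  shows "aut_factor (A ** B) \<tau> = aut_factor A (lin_frac B \<tau>) * aut_factor B \<tau>"
  using aut_factor_nonzero[OF assms]
  by (simp add: aut_factor_def lin_frac_def matrix_matrix_mult_def sum_2 field_simps)

lemma lin_frac_mult:
  assumes "det A = 1" "det B = 1" "\<tau> \<in> uhp"
  shows "lin_frac (A ** B) \<tau> = lin_frac A (lin_frac B \<tau>)"
proof -
  have nz: "aut_factor B \<tau> \<noteq> 0" by (rule aut_factor_nonzero[OF assms(2,3)])
  have num: "of_real ((A ** B)$1$1) * \<tau> + of_real ((A ** B)$1$2) =
      (of_real (A$1$1) * lin_frac B \<tau> + of_real (A$1$2)) * aut_factor B \<tau>"
    using nz by (simp add: aut_factor_def lin_frac_def matrix_matrix_mult_def sum_2 field_simps)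
  have "lin_frac (A ** B) \<tau> = ((of_real (A$1$1) * lin_frac B \<tau> + of_real (A$1$2)) * aut_factor B \<tau>)
      / aut_factor (A ** B) \<tau>"
    unfolding num[symmetric] by (simp add: lin_frac_def aut_factor_def)
  also have "\<dots> = lin_frac A (lin_frac B \<tau>)"
    unfolding aut_factor_mult[OF assms(2,3)] using nz
    by (simp add: lin_frac_def[of A] aut_factor_def[of A])
  finally show ?thesis .
qed

lemma lin_frac_holomorphic: "det A = 1 \<Longrightarrow> lin_frac A holomorphic_on uhp"
  unfolding lin_frac_def using aut_factor_nonzero
  by (intro holomorphic_intros) (auto simp: aut_factor_def)

lemma mat_1_entries: "(mat 1 :: real^2^2)$1$1 = 1" "(mat 1 :: real^2^2)$1$2 = 0"
  "(mat 1 :: real^2^2)$2$1 = 0" "(mat 1 :: real^2^2)$2$2 = 1"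
  by (simp_all add: mat_def)

lemma lin_frac_1: "lin_frac (mat 1) \<tau> = \<tau>"
  by (simp add: lin_frac_def mat_1_entries)

definition adj2 :: "real^2^2 \<Rightarrow> real^2^2" where
  "adj2 A = vector [vector [A$2$2, - A$1$2], vector [- A$2$1, A$1$1]]"

lemma adj2:
  assumes "det A = 1"
  shows "adj2 A ** A = mat 1" "det (adj2 A) = 1"
  using assms
  by (auto simp: adj2_def det_2 matrix_matrix_mult_def sum_2 vec_eq_iff forall_2 mat_def algebra_simps)

lemma Mp2R_inverse:
  assumes "(A, \<phi>) \<in> carrier Mp2R"
  obtains \<psi> where "(adj2 A, \<psi>) \<in> carrier Mp2R" "(adj2 A, \<psi>) \<otimes>\<^bsub>Mp2R\<^esub> (A, \<phi>) = \<one>\<^bsub>Mp2R\<^esub>"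
proof -
  from assms have A: "det A = 1" and \<phi>: "\<phi> holomorphic_on uhp"
    and sq: "\<And>\<tau>. \<tau> \<in> uhp \<Longrightarrow> (\<phi> \<tau>)\<^sup>2 = aut_factor A \<tau>"
    by (auto simp: Mp2R_def)
  note adj = adj2[OF A]
  have "A ** adj2 A = mat 1" using adj(1) matrix_left_right_inverse by blast
  hence r: "lin_frac A (lin_frac (adj2 A) \<tau>) = \<tau>" if "\<tau> \<in> uhp" for \<tau>
    using lin_frac_mult[OF A adj(2) that] by (simp add: lin_frac_1)
  have l: "lin_frac (adj2 A) (lin_frac A \<tau>) = \<tau>" if "\<tau> \<in> uhp" for \<tau>
    using lin_frac_mult[OF adj(2) A that] by (simp add: adj(1) lin_frac_1)
  have nz: "\<phi> \<tau> \<noteq> 0" if "\<tau> \<in> uhp" for \<tau>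
    using sq[OF that] aut_factor_nonzero[OF A that] by auto
  define \<psi> where "\<psi> = (\<lambda>\<tau>\<in>uhp. 1 / \<phi> (lin_frac (adj2 A) \<tau>))"
  have "(\<lambda>\<tau>. 1 / (\<phi> \<circ> lin_frac (adj2 A)) \<tau>) holomorphic_on uhp"
    using nz lin_frac_uhp[OF adj(2)]
    by (intro holomorphic_on_divide holomorphic_on_const
          holomorphic_on_compose_gen[OF lin_frac_holomorphic[OF adj(2)] \<phi>]) auto
  hence "\<psi> holomorphic_on uhp"
    by (rule holomorphic_transform) (simp add: \<psi>_def)
  moreover have "(\<psi> \<tau>)\<^sup>2 = aut_factor (adj2 A) \<tau>" if t: "\<tau> \<in> uhp" for \<tau>
  proof -
    have t': "lin_frac (adj2 A) \<tau> \<in> uhp" by (rule lin_frac_uhp[OF adj(2) t])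
    have "aut_factor (A ** adj2 A) \<tau> = 1"
      by (simp add: \<open>A ** adj2 A = mat 1\<close> aut_factor_def mat_1_entries)
    hence "aut_factor A (lin_frac (adj2 A) \<tau>) * aut_factor (adj2 A) \<tau> = 1"
      by (simp add: aut_factor_mult[OF adj(2) t])
    thus ?thesis using t nz[OF t'] by (simp add: \<psi>_def power_divide sq[OF t'] divide_eq_eq mult.commute
          aut_factor_nonzero[OF A t'])
  qed
  ultimately have "(adj2 A, \<psi>) \<in> carrier Mp2R" using adj(2) by (simp add: Mp2R_def \<psi>_def)
  moreover have "(adj2 A, \<psi>) \<otimes>\<^bsub>Mp2R\<^esub> (A, \<phi>) = \<one>\<^bsub>Mp2R\<^esub>"
    using adj(1) nz l lin_frac_uhp[OF A] by (auto simp: Mp2R_def \<psi>_def fun_eq_iff)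
  ultimately show ?thesis by (rule that)
qed

lemma group_Mp2R: "group Mp2R"
proof (rule groupI)
  fix g h assume g: "g \<in> carrier Mp2R" and h: "h \<in> carrier Mp2R"
  obtain A \<phi> B \<psi> where gh: "g = (A, \<phi>)" "h = (B, \<psi>)" by (metis surj_pair)
  have A: "det A = 1" "\<phi> holomorphic_on uhp" "\<And>\<tau>. \<tau> \<in> uhp \<Longrightarrow> (\<phi> \<tau>)\<^sup>2 = aut_factor A \<tau>"
    and B: "det B = 1" "\<psi> holomorphic_on uhp" "\<And>\<tau>. \<tau> \<in> uhp \<Longrightarrow> (\<psi> \<tau>)\<^sup>2 = aut_factor B \<tau>"
    using g h by (auto simp: gh Mp2R_def)
  have "(\<lambda>\<tau>. (\<phi> \<circ> lin_frac B) \<tau> * \<psi> \<tau>) holomorphic_on uhp"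
    using lin_frac_uhp[OF B(1)]
    by (intro holomorphic_on_mult B holomorphic_on_compose_gen[OF lin_frac_holomorphic[OF B(1)] A(2)]) auto
  hence "(\<lambda>\<tau>\<in>uhp. \<phi> (lin_frac B \<tau>) * \<psi> \<tau>) holomorphic_on uhp"
    by (rule holomorphic_transform) simp
  thus "g \<otimes>\<^bsub>Mp2R\<^esub> h \<in> carrier Mp2R"
    using A B lin_frac_uhp[OF B(1)]
    by (simp add: gh Mp2R_def det_mul power_mult_distrib aut_factor_mult)
next
  show "\<one>\<^bsub>Mp2R\<^esub> \<in> carrier Mp2R"
    using holomorphic_transform[of "\<lambda>_. 1" uhp "\<lambda>\<tau>\<in>uhp. 1"]
    by (simp add: Mp2R_def aut_factor_def mat_1_entries)
next
  fix g h k assume "g \<in> carrier Mp2R" "h \<in> carrier Mp2R" "k \<in> carrier Mp2R"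
  thus "g \<otimes>\<^bsub>Mp2R\<^esub> h \<otimes>\<^bsub>Mp2R\<^esub> k = g \<otimes>\<^bsub>Mp2R\<^esub> (h \<otimes>\<^bsub>Mp2R\<^esub> k)"
    by (auto simp: Mp2R_def matrix_mul_assoc lin_frac_mult lin_frac_uhp mult.assoc fun_eq_iff)
next
  fix g assume "g \<in> carrier Mp2R"
  thus "\<one>\<^bsub>Mp2R\<^esub> \<otimes>\<^bsub>Mp2R\<^esub> g = g"
    by (auto simp: Mp2R_def lin_frac_uhp fun_eq_iff extensional_def)
next
  fix g assume "g \<in> carrier Mp2R"
  thus "\<exists>h\<in>carrier Mp2R. h \<otimes>\<^bsub>Mp2R\<^esub> g = \<one>\<^bsub>Mp2R\<^esub>"
    by (metis Mp2R_inverse surj_pair)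
qed

lemma group_Mp2Z: "group Mp2Z"
proof -
  interpret group Mp2R by (rule group_Mp2R)
  have mult: "A ** B \<in> SL2Z" if "A \<in> SL2Z" "B \<in> SL2Z" for A B
    using that unfolding SL2Z_def by (simp add: det_mul) (simp add: matrix_matrix_mult_def sum_2)
  have adj: "adj2 A \<in> SL2Z" if "A \<in> SL2Z" for A
    using that adj2(2)[of A] by (auto simp: SL2Z_def forall_2 adj2_def)
  have "subgroup {g \<in> carrier Mp2R. fst g \<in> SL2Z} Mp2R"
  proof (rule subgroupI)
    show "{g \<in> carrier Mp2R. fst g \<in> SL2Z} \<noteq> {}"
    proof -
      have "fst \<one>\<^bsub>Mp2R\<^esub> \<in> SL2Z" by (simp add: Mp2R_def SL2Z_def) (simp add: mat_def)
      with one_closed show ?thesis by blast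
    qed
  next
    fix g assume g: "g \<in> {g \<in> carrier Mp2R. fst g \<in> SL2Z}"
    obtain A \<phi> where gA: "g = (A, \<phi>)" by (metis surj_pair)
    obtain \<psi> where "(adj2 A, \<psi>) \<in> carrier Mp2R" "(adj2 A, \<psi>) \<otimes>\<^bsub>Mp2R\<^esub> g = \<one>\<^bsub>Mp2R\<^esub>"
      using g Mp2R_inverse unfolding gA by blast
    moreover from this have "inv\<^bsub>Mp2R\<^esub> g = (adj2 A, \<psi>)"
      using g by (intro inv_equality) simp_all
    ultimately show "inv\<^bsub>Mp2R\<^esub> g \<in> {g \<in> carrier Mp2R. fst g \<in> SL2Z}"
      using g adj by (simp add: gA)
  next
    fix g h assume "g \<in> {g \<in> carrier Mp2R. fst g \<in> SL2Z}" "h \<in> {g \<in> carrier Mp2R. fst g \<in> SL2Z}"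
    moreover from this have "fst (g \<otimes>\<^bsub>Mp2R\<^esub> h) = fst g ** fst h"
      by (simp add: Mp2R_def case_prod_unfold)
    ultimately show "g \<otimes>\<^bsub>Mp2R\<^esub> h \<in> {g \<in> carrier Mp2R. fst g \<in> SL2Z}"
      using mult m_closed by simp
  qed auto
  thus ?thesis using subgroup_imp_group by (simp add: Mp2Z_def)
qed

lemma mp_T_S_in_Mp2Z: "mp_T \<in> carrier Mp2Z" "mp_S \<in> carrier Mp2Z"
proof -
  have "(\<lambda>\<tau>\<in>uhp. 1) holomorphic_on uhp"
    using holomorphic_transform[of "\<lambda>_. 1" uhp "\<lambda>\<tau>\<in>uhp. 1"] by simp
  thus "mp_T \<in> carrier Mp2Z"
    by (simp add: mp_T_def Mp2Z_def Mp2R_def SL2Z_def det_2 aut_factor_def forall_2)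
  have "csqrt holomorphic_on uhp"
    by (rule holomorphic_on_csqrt') (auto simp: uhp_def complex_nonpos_Reals_iff)
  hence "(\<lambda>\<tau>\<in>uhp. csqrt \<tau>) holomorphic_on uhp"
    by (rule holomorphic_transform) simp
  thus "mp_S \<in> carrier Mp2Z"
    by (simp add: mp_S_def Mp2Z_def Mp2R_def SL2Z_def det_2 aut_factor_def forall_2)
qed

end

theory Submission
  imports Defs
begin

text \<open>
  At the class of \<open>x \<in> \<Lambda>\<^sup>*\<close> the \<open>(\<alpha>, \<beta>)\<close> summand on the right is \<open>\<^bold>e(-(x, \<alpha>))\<close> times the
  sum of the Gaussian terms over \<open>x + \<beta> + \<Lambda>\<close>, because \<open>(\<Lambda>, \<alpha>)\<close> and \<open>(\<beta>, \<alpha>)\<close> are integral. Summing over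
  \<open>\<alpha> \<in> H\<close> gives \<open>|H|\<close> if \<open>x \<in> L\<^sup>*\<close> and \<open>0\<close> otherwise, and summing over \<open>\<beta> \<in> H\<close> assembles the
  cosets of \<open>\<Lambda>\<close> into \<open>x + L\<close>, which leaves the component of \<open>\<up>\<Theta>\<^sub>L\<close>. The second identity follows since the
  two arrows are adjoint. As \<^const>\<open>infsum\<close> of a non-summable family and \<^const>\<open>sum\<close> over an infinite
  set are \<open>0\<close>, absolute convergence of the theta series and finiteness of the discriminant group are
  genuine steps.
\<close>

section \<open>Gaussian sums over lattice translates\<close>

lemma bilinear_eq_0_on_span_right:
  assumes "bilinear Q" "\<And>y. y \<in> b \<Longrightarrow> Q x y = 0" "y \<in> span b"
  shows "Q x y = 0"
proof -
  have "linear (Q x)" using assms(1) by (simp add: bilinear_def)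
  thus ?thesis using linear_eq_0_on_span[of "Q x" b y] assms by blast
qed

text \<open>Gram-Schmidt by induction on \<open>b\<close>. The hypothesis is applied both to
  \<open>x\<close> and to the new vector \<open>a\<close>; the component \<open>a - q\<close>
  orthogonal to the old span then corrects the projection of \<open>x\<close>.\<close>

lemma bilinear_orthogonal_projection:
  fixes Q :: "'a::real_vector \<Rightarrow> 'a \<Rightarrow> real"
  assumes bil: "bilinear Q" and pos: "\<And>x. x \<noteq> 0 \<Longrightarrow> 0 < Q x x" and "finite b"
  shows "\<exists>p\<in>span b. \<forall>y\<in>b. Q (x - p) y = 0"
  using \<open>finite b\<close>
proof (induction b arbitrary: x rule: finite_induct)
  case empty
  thus ?case by simp
next
  case (insert a b)
  obtain p where p: "p \<in> span b" "\<And>y. y \<in> b \<Longrightarrow> Q (x - p) y = 0" using insert.IH by blast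
  obtain q where q: "q \<in> span b" "\<And>y. y \<in> b \<Longrightarrow> Q (a - q) y = 0" using insert.IH by blast
  have sub: "span b \<subseteq> span (insert a b)" by (rule span_mono) blast
  show ?case
  proof (cases "a = q")
    case True
    \<comment> \<open>Here \<open>a\<close> already lies in the old span, so nothing has to be
      corrected.\<close>
    hence "Q (x - p) a = 0" using bilinear_eq_0_on_span_right[OF bil p(2)] q(1) by blast
    thus ?thesis using p sub by blast
  next
    case False
    have "Q (a - q) q = 0" using bilinear_eq_0_on_span_right[OF bil q(2,1)] .
    hence "Q (a - q) a = Q (a - q) (a - q)" by (simp add: bilinear_rsub[OF bil])
    hence nz: "Q (a - q) a \<noteq> 0" using pos[of "a - q"] False by simp
    \<comment> \<open>This is the coefficient that makes \<open>Q (x - r) a\<close> vanish; adding a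
      multiple of \<open>a - q\<close> keeps orthogonality to \<open>b\<close>.\<close>
    define t where "t = Q (x - p) a / Q (a - q) a"
    define r where "r = p + t *\<^sub>R (a - q)"
    have Qr: "Q (x - r) y = Q (x - p) y - t * Q (a - q) y" for y
    proof -
      have "x - r = (x - p) - t *\<^sub>R (a - q)" by (simp add: r_def)
      thus ?thesis by (simp only: bilinear_lsub[OF bil] bilinear_lmul[OF bil] real_scaleR_def)
    qed
    have "a \<in> span (insert a b)" by (simp add: span_base)
    hence "r \<in> span (insert a b)"
      unfolding r_def using p(1) q(1) sub by (intro span_add span_scale span_diff) auto
    moreover have "Q (x - r) y = 0" if "y \<in> insert a b" for y
      using that p(2) q(2) nz by (auto simp: Qr t_def)
    ultimately show ?thesis by blast
  qed
qed

text \<open>The type carries no norm, so the comparison with the coordinate norm is algebraic: the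
  coefficient of \<open>i\<close> is read off by pairing with the part \<open>w\<close> of
  \<open>i\<close> orthogonal to the other basis vectors, and Bessel's inequality for
  \<open>w\<close> bounds its square.\<close>

lemma coefficients_bound:
  fixes Q :: "'a::real_vector \<Rightarrow> 'a \<Rightarrow> real"
  assumes bil: "bilinear Q" and sym: "\<And>x y. Q x y = Q y x" and pos: "\<And>x. x \<noteq> 0 \<Longrightarrow> 0 < Q x x"
    and b: "finite b" "independent b"
  obtains M where "M > 0"
    "\<And>c. (\<Sum>i\<in>b. (c i)\<^sup>2) \<le> M * Q (\<Sum>i\<in>b. c i *\<^sub>R i) (\<Sum>i\<in>b. c i *\<^sub>R i)"
proof -
  have Q0: "0 \<le> Q x x" for x
    using pos[of x] by (cases "x = 0") (auto simp: bilinear_lzero[OF bil])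
  have "\<exists>m>0. \<forall>c. m * (c i)\<^sup>2 \<le> Q (\<Sum>j\<in>b. c j *\<^sub>R j) (\<Sum>j\<in>b. c j *\<^sub>R j)" if i: "i \<in> b" for i
  proof -
    obtain p where p: "p \<in> span (b - {i})" "\<And>y. y \<in> b - {i} \<Longrightarrow> Q (i - p) y = 0"
      using bilinear_orthogonal_projection[OF bil pos, of "b - {i}" i] b(1) by auto
    define w where "w = i - p"
    have "i \<notin> span (b - {i})" using b(2) i by (simp add: dependent_def)
    hence "w \<noteq> 0" using p(1) by (auto simp: w_def)
    have "Q w p = 0" unfolding w_def using bilinear_eq_0_on_span_right[OF bil p(2,1)] .
    hence Qwi: "Q w i = Q w w" by (simp add: w_def bilinear_rsub[OF bil])
    have "Q w w * (c i)\<^sup>2 \<le> Q (\<Sum>j\<in>b. c j *\<^sub>R j) (\<Sum>j\<in>b. c j *\<^sub>R j)" for c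
    proof -
      define x where "x = (\<Sum>j\<in>b. c j *\<^sub>R j)"
      have "linear (Q w)" using bil by (simp add: bilinear_def)
      hence "Q w x = (\<Sum>j\<in>b. c j * Q w j)"
        by (simp add: x_def linear_sum linear_scale)
      also have "\<dots> = c i * Q w w"
        using p(2) Qwi by (simp add: w_def[symmetric] sum.remove[OF b(1) i])
      finally have Qwx: "Q w x = c i * Q w w" .
      \<comment> \<open>Bessel's inequality: \<open>c i\<close> times \<open>w\<close> is the
        projection of \<open>x\<close> to the line through \<open>w\<close>.\<close>
      have "0 \<le> Q (x - c i *\<^sub>R w) (x - c i *\<^sub>R w)" by (rule Q0)
      also have "\<dots> = Q x x - Q w w * (c i)\<^sup>2"
        using Qwx sym[of x w]
        by (simp add: bilinear_lsub[OF bil] bilinear_rsub[OF bil] bilinear_lmul[OF bil]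
            bilinear_rmul[OF bil] power2_eq_square)
      finally show ?thesis by (simp add: x_def)
    qed
    thus ?thesis using pos[OF \<open>w \<noteq> 0\<close>] by blast
  qed
  then obtain m where m: "\<And>i. i \<in> b \<Longrightarrow> m i > 0"
    "\<And>i c. i \<in> b \<Longrightarrow> m i * (c i)\<^sup>2 \<le> Q (\<Sum>j\<in>b. c j *\<^sub>R j) (\<Sum>j\<in>b. c j *\<^sub>R j)"
    by metis
  \<comment> \<open>The summand 1 keeps \<open>M\<close> positive when \<open>b\<close> is
    empty.\<close>
  define M where "M = 1 + (\<Sum>i\<in>b. 1 / m i)"
  show thesis
  proof
    show "M > 0" using m(1) unfolding M_def by (intro add_pos_nonneg sum_nonneg) (auto intro: less_imp_le)
    fix c
    define q where "q = Q (\<Sum>j\<in>b. c j *\<^sub>R j) (\<Sum>j\<in>b. c j *\<^sub>R j)"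
    have "(\<Sum>i\<in>b. (c i)\<^sup>2) \<le> (\<Sum>i\<in>b. 1 / m i * q)"
      using m by (intro sum_mono) (simp add: q_def field_simps)
    also have "\<dots> \<le> M * q"
      using Q0 by (simp add: M_def q_def algebra_simps sum_distrib_right)
    finally show "(\<Sum>i\<in>b. (c i)\<^sup>2) \<le> M * Q (\<Sum>i\<in>b. c i *\<^sub>R i) (\<Sum>i\<in>b. c i *\<^sub>R i)"
      by (simp add: q_def)
  qed
qed

section \<open>Summability over integer points\<close>

lemma summable_on_exp_neg_abs_int: "(\<lambda>n::int. exp (- \<bar>of_int n\<bar> :: real)) summable_on UNIV"
proof -
  have geo: "(\<lambda>n::nat. exp (- real n)) summable_on UNIV"
  proof (rule norm_summable_imp_summable_on)
    have "summable (\<lambda>n. (exp (- 1) :: real) ^ n)" by (rule summable_geometric) simp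
    thus "summable (\<lambda>n. norm (exp (- real n)))" by (simp add: exp_of_nat_mult[symmetric])
  qed
  \<comment> \<open>The integers are covered by two copies of the naturals; the overlap at 0 does no
    harm to summability.\<close>
  have "(\<lambda>n::int. exp (- \<bar>of_int n\<bar> :: real)) summable_on range int"
    using geo by (subst summable_on_reindex) (auto simp: o_def)
  moreover have "(\<lambda>n::int. exp (- \<bar>of_int n\<bar> :: real)) summable_on range (\<lambda>n. - int n)"
    using geo by (subst summable_on_reindex) (auto simp: o_def inj_def)
  moreover have "range int \<union> range (\<lambda>n. - int n) = UNIV"
    by (auto intro: int_cases2)
  ultimately show ?thesis by (metis summable_on_union)
qed

text \<open>The terms are nonnegative, so bounded finite partial sums suffice. A finite set of
  functions lies in a finite box, over which the sum factors into one-dimensional sums.\<close>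

lemma summable_on_PiE_prod:
  fixes g :: "'b \<Rightarrow> real"
  assumes "finite I" "g summable_on A" "\<And>n. n \<in> A \<Longrightarrow> 0 \<le> g n"
  shows "(\<lambda>c. \<Prod>i\<in>I. g (c i)) summable_on PiE I (\<lambda>_. A)"
proof (rule nonneg_bdd_above_summable_on)
  show "0 \<le> (\<Prod>i\<in>I. g (c i))" if "c \<in> PiE I (\<lambda>_. A)" for c
    using that assms(3) by (intro prod_nonneg) auto
  show "bdd_above (sum (\<lambda>c. \<Prod>i\<in>I. g (c i)) ` {F. F \<subseteq> PiE I (\<lambda>_. A) \<and> finite F})"
  proof (rule bdd_aboveI2)
    fix F assume "F \<in> {F. F \<subseteq> PiE I (\<lambda>_. A) \<and> finite F}"
    hence F: "F \<subseteq> PiE I (\<lambda>_. A)" "finite F" by auto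
    define X where "X = (\<Union>c\<in>F. c ` I)"
    have X: "finite X" "X \<subseteq> A" "F \<subseteq> PiE I (\<lambda>_. X)" using F assms(1) by (auto simp: X_def)
    have "(\<Sum>c\<in>F. \<Prod>i\<in>I. g (c i)) \<le> (\<Sum>c\<in>PiE I (\<lambda>_. X). \<Prod>i\<in>I. g (c i))"
    proof (rule sum_mono2[OF _ X(3)])
      show "finite (PiE I (\<lambda>_. X))" using X(1) assms(1) by (simp add: finite_PiE)
      show "0 \<le> (\<Prod>i\<in>I. g (c i))" if "c \<in> PiE I (\<lambda>_. X) - F" for c
        using that assms(3) X(2) by (intro prod_nonneg) auto
    qed
    also have "\<dots> = (\<Prod>i\<in>I. \<Sum>n\<in>X. g n)"
      using prod_sum_PiE[of I "\<lambda>_. X" "\<lambda>_. g"] assms(1) X(1) by simp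
    also have "\<dots> \<le> (\<Prod>i\<in>I. infsum g A)"
      using assms(3) X by (intro prod_mono conjI sum_nonneg finite_sum_le_infsum assms(2)) auto
    finally show "(\<Sum>c\<in>F. \<Prod>i\<in>I. g (c i)) \<le> (\<Prod>i\<in>I. infsum g A)" .
  qed
qed

text \<open>Completing the square. The term -|t| kept on the right supplies exponential decay in
  each coordinate of a Gaussian sum.\<close>

lemma linear_minus_quadratic_bound:
  fixes a :: real
  assumes "a > 0"
  shows "d * \<bar>t\<bar> - a * t\<^sup>2 \<le> (d + 1)\<^sup>2 / (4 * a) - \<bar>t\<bar>"
proof -
  have "0 \<le> (2 * a * \<bar>t\<bar> - (d + 1))\<^sup>2" by simp
  also have "\<dots> = 4 * a\<^sup>2 * t\<^sup>2 - 4 * a * \<bar>t\<bar> * (d + 1) + (d + 1)\<^sup>2"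
    by (simp add: power2_diff power_mult_distrib)
  finally show ?thesis using assms by (simp add: field_simps power2_eq_square)
qed

text \<open>In coordinates the exponent is bounded by a sum of one-variable expressions, so the
  series is dominated by a product of series over the integers.\<close>

lemma summable_on_gaussian_translate:
  fixes Q :: "'a::real_vector \<Rightarrow> 'a \<Rightarrow> real"
  assumes bil: "bilinear Q" and sym: "\<And>x y. Q x y = Q y x" and pos: "\<And>x. x \<noteq> 0 \<Longrightarrow> 0 < Q x x"
    and l: "linear l" and L: "full_lattice L" and a: "a > 0"
  shows "(\<lambda>x. exp (l x - a * Q x x)) summable_on (x0 +o L)"
proof -
  obtain b where b: "finite b" "independent b" "span b = UNIV"
    and L_eq: "L = {\<Sum>x\<in>b. of_int (c x) *\<^sub>R x | c. True}"
    using L unfolding full_lattice_def by blast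
  obtain M where M: "M > 0"
    "\<And>c. (\<Sum>i\<in>b. (c i)\<^sup>2) \<le> M * Q (\<Sum>i\<in>b. c i *\<^sub>R i) (\<Sum>i\<in>b. c i *\<^sub>R i)"
    using coefficients_bound[OF bil sym pos b(1,2)] by metis
  define e where "e = representation b x0"
  have x0: "x0 = (\<Sum>i\<in>b. e i *\<^sub>R i)"
    unfolding e_def using b by (subst real_vector.sum_representation_eq) auto
  define h where "h c = x0 + (\<Sum>i\<in>b. of_int (c i) *\<^sub>R i)" for c :: "'a \<Rightarrow> int"
  \<comment> \<open>Integer coordinate vectors, fixed outside \<open>b\<close> so that
    \<open>h\<close> is injective on them.\<close>
  define P where "P = PiE b (\<lambda>_. UNIV :: int set)"
  have h_eq: "h c = (\<Sum>i\<in>b. (e i + of_int (c i)) *\<^sub>R i)" for c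
    by (simp add: h_def x0 scaleR_left_distrib sum.distrib)
  have inj: "inj_on h P"
  proof (rule inj_onI)
    fix c d assume cd: "c \<in> P" "d \<in> P" "h c = h d"
    hence "(\<Sum>i\<in>b. of_int (c i - d i) *\<^sub>R i) = (0 :: 'a)"
      by (simp add: h_def scaleR_left_diff_distrib sum_subtractf)
    hence "(of_int (c i - d i) :: real) = 0" if "i \<in> b" for i
      using real_vector.independentD[OF b(2,1) subset_refl _ that, of "\<lambda>i. of_int (c i - d i)"] by simp
    thus "c = d" using cd by (intro PiE_ext[of c b "\<lambda>_. UNIV" d]) (auto simp: P_def)
  qed
  have img: "x0 +o L = h ` P"
  proof (intro Set.set_eqI iffI)
    fix x assume "x \<in> x0 +o L"
    then obtain c where c: "x = x0 + (\<Sum>i\<in>b. of_int (c i) *\<^sub>R i)"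
      by (auto simp: elt_set_plus_def L_eq)
    have "x = h (restrict c b)" unfolding c h_def by (intro arg_cong2[where f = "(+)"] sum.cong) auto
    thus "x \<in> h ` P" by (auto simp: P_def)
  next
    fix x assume "x \<in> h ` P"
    thus "x \<in> x0 +o L" by (auto simp: elt_set_plus_def L_eq h_def)
  qed
  define d where "d i = \<bar>l i\<bar>" for i
  \<comment> \<open>\<open>K\<close> gathers the constants from completing the square and the loss
    |e i| in passing from the real coordinate e i + c i to its integer part c i.\<close>
  define K where "K = (\<Sum>i\<in>b. (d i + 1)\<^sup>2 / (4 * (a / M)) + \<bar>e i\<bar>)"
  have bound: "exp (l (h c) - a * Q (h c) (h c)) \<le> exp K * (\<Prod>i\<in>b. exp (- \<bar>of_int (c i)\<bar>))" for c
  proof -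
    define y where "y i = e i + of_int (c i)" for i
    have hy: "h c = (\<Sum>i\<in>b. y i *\<^sub>R i)" by (simp add: h_eq y_def)
    have "l (h c) = (\<Sum>i\<in>b. y i * l i)"
      by (simp add: hy linear_sum[OF l] linear_scale[OF l])
    also have "\<dots> \<le> (\<Sum>i\<in>b. d i * \<bar>y i\<bar>)"
      by (intro sum_mono) (metis abs_ge_self abs_mult d_def mult.commute)
    finally have 1: "l (h c) \<le> (\<Sum>i\<in>b. d i * \<bar>y i\<bar>)" .
    have "(a / M) * (\<Sum>i\<in>b. (y i)\<^sup>2) \<le> (a / M) * (M * Q (h c) (h c))"
      using M a unfolding hy by (intro mult_left_mono) auto
    hence "l (h c) - a * Q (h c) (h c) \<le> (\<Sum>i\<in>b. d i * \<bar>y i\<bar> - (a / M) * (y i)\<^sup>2)"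
      using 1 M(1) by (simp add: sum_subtractf sum_distrib_left)
    also have "\<dots> \<le> (\<Sum>i\<in>b. (d i + 1)\<^sup>2 / (4 * (a / M)) + \<bar>e i\<bar> - \<bar>of_int (c i)\<bar>)"
    proof (rule sum_mono)
      fix i
      have "\<bar>of_int (c i)\<bar> - \<bar>e i\<bar> \<le> \<bar>y i\<bar>" by (simp add: y_def)
      thus "d i * \<bar>y i\<bar> - (a / M) * (y i)\<^sup>2 \<le> (d i + 1)\<^sup>2 / (4 * (a / M)) + \<bar>e i\<bar> - \<bar>of_int (c i)\<bar>"
        using linear_minus_quadratic_bound[of "a / M" "d i" "y i"] a M(1) by simp
    qed
    also have "\<dots> = K + (\<Sum>i\<in>b. - \<bar>of_int (c i)\<bar>)" by (simp add: K_def sum_subtractf sum_negf)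
    finally show ?thesis
      by (simp only: exp_sum[OF b(1), symmetric] exp_add[symmetric] exp_le_cancel_iff)
  qed
  have "(\<lambda>c. exp K * (\<Prod>i\<in>b. exp (- \<bar>of_int (c i)\<bar>))) summable_on P"
    unfolding P_def
    by (intro summable_on_cmult_right summable_on_PiE_prod[OF b(1) summable_on_exp_neg_abs_int]) auto
  hence "(\<lambda>c. exp (l (h c) - a * Q (h c) (h c))) summable_on P"
    by (rule summable_on_comparison_test) (use bound in auto)
  thus ?thesis unfolding img using inj by (simp add: summable_on_reindex o_def)
qed

section \<open>The majorant of a point of the Grassmannian\<close>

text \<open>Since \<open>v_+\<close> and \<open>v_-\<close> meet only in 0, the definite
  descriptions are pinned down by any one decomposition; linearity of the projections then follows
  by exhibiting decompositions.\<close>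

lemma proj_eqI:
  assumes v: "v \<in> Grassmannian B" and p: "p \<in> fst v" and n: "n \<in> snd v"
  shows "proj_plus v (p + n) = p" "proj_minus v (p + n) = n"
proof -
  have P: "subspace (fst v)" "subspace (snd v)" "fst v \<inter> snd v = {0}"
    using v by (auto simp: Grassmannian_def)
  have uniq: "q = p' \<and> m = n'" if "q \<in> fst v" "p' \<in> fst v" "m \<in> snd v" "n' \<in> snd v" "q + m = p' + n'"
    for q p' m n'
  proof -
    have "q - p' = n' - m" using that(5) by (simp add: algebra_simps)
    moreover have "q - p' \<in> fst v" "n' - m \<in> snd v" using P that by (auto intro: subspace_diff)
    ultimately have "q - p' \<in> {0}" using P(3) by (metis IntI)
    thus ?thesis using that(5) by simp
  qed
  show "proj_plus v (p + n) = p"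
    unfolding proj_plus_def using p n
    by (intro the_equality) (auto dest: uniq[of _ p "p + n - _" n])
  show "proj_minus v (p + n) = n"
    unfolding proj_minus_def using p n
    by (intro the_equality) (auto dest: uniq[of "p + n - _" p _ n])
qed

lemma Grassmannian_decompose:
  assumes "v \<in> Grassmannian B"
  shows "proj_plus v x \<in> fst v" "proj_minus v x \<in> snd v" "proj_plus v x + proj_minus v x = x"
proof -
  have "x \<in> fst v + snd v" using assms by (auto simp: Grassmannian_def)
  then obtain p n where x: "x = p + n" and pn: "p \<in> fst v" "n \<in> snd v" by (auto elim: set_plus_elim)
  note eq = proj_eqI[OF assms pn]
  show "proj_plus v x \<in> fst v" "proj_minus v x \<in> snd v" "proj_plus v x + proj_minus v x = x"
    using pn by (simp_all add: x eq)
qed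

lemma linear_proj:
  assumes v: "v \<in> Grassmannian B"
  shows "linear (proj_plus v)" "linear (proj_minus v)"
proof -
  have P: "subspace (fst v)" "subspace (snd v)" using v by (auto simp: Grassmannian_def)
  note D = Grassmannian_decompose[OF v]
  have add: "proj_plus v (x + y) = proj_plus v x + proj_plus v y"
           "proj_minus v (x + y) = proj_minus v x + proj_minus v y" for x y
  proof -
    have "x + y = (proj_plus v x + proj_plus v y) + (proj_minus v x + proj_minus v y)"
      using D(3)[of x] D(3)[of y] by (metis add.assoc add.commute)
    thus "proj_plus v (x + y) = proj_plus v x + proj_plus v y"
         "proj_minus v (x + y) = proj_minus v x + proj_minus v y"
      using proj_eqI[OF v] subspace_add[OF P(1) D(1) D(1)] subspace_add[OF P(2) D(2) D(2)] by metis+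
  qed
  have scale: "proj_plus v (c *\<^sub>R x) = c *\<^sub>R proj_plus v x"
           "proj_minus v (c *\<^sub>R x) = c *\<^sub>R proj_minus v x" for c x
  proof -
    have "c *\<^sub>R x = c *\<^sub>R proj_plus v x + c *\<^sub>R proj_minus v x"
      using D(3)[of x] by (metis scaleR_add_right)
    thus "proj_plus v (c *\<^sub>R x) = c *\<^sub>R proj_plus v x"
         "proj_minus v (c *\<^sub>R x) = c *\<^sub>R proj_minus v x"
      using proj_eqI[OF v] subspace_scale[OF P(1) D(1)] subspace_scale[OF P(2) D(2)] by metis+
  qed
  show "linear (proj_plus v)" "linear (proj_minus v)" by (intro linearI add scale)+
qed

text \<open>The Siegel majorant of \<open>B\<close> at \<open>v\<close>: the sign flip on
  \<open>v_-\<close> makes it positive definite, and it governs the absolute value of the theta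
  terms.\<close>

definition majorant :: "('a::real_vector \<Rightarrow> 'a \<Rightarrow> real) \<Rightarrow> 'a set \<times> 'a set \<Rightarrow> 'a \<Rightarrow> 'a \<Rightarrow> real" where
  "majorant B v x y = B (proj_plus v x) (proj_plus v y) - B (proj_minus v x) (proj_minus v y)"

lemma bilinear_majorant:
  assumes "bilinear B" "v \<in> Grassmannian B"
  shows "bilinear (majorant B v)"
  unfolding bilinear_def majorant_def
  by (intro conjI allI linearI)
     (simp_all add: linear_add[OF linear_proj(1)[OF assms(2)]] linear_add[OF linear_proj(2)[OF assms(2)]]
        linear_scale[OF linear_proj(1)[OF assms(2)]] linear_scale[OF linear_proj(2)[OF assms(2)]]
        bilinear_ladd[OF assms(1)] bilinear_radd[OF assms(1)]
        bilinear_lmul[OF assms(1)] bilinear_rmul[OF assms(1)] algebra_simps)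

lemma majorant_pos:
  assumes bil: "bilinear B" and v: "v \<in> Grassmannian B" and "x \<noteq> 0"
  shows "0 < majorant B v x x"
proof -
  note D = Grassmannian_decompose[OF v, of x]
  have "proj_plus v x \<noteq> 0 \<or> proj_minus v x \<noteq> 0" using D(3) \<open>x \<noteq> 0\<close> by auto
  moreover have "p \<in> fst v \<Longrightarrow> p \<noteq> 0 \<Longrightarrow> 0 < B p p" "p \<in> snd v \<Longrightarrow> p \<noteq> 0 \<Longrightarrow> B p p < 0" for p
    using v by (auto simp: Grassmannian_def)
  moreover have "B 0 0 = 0" by (rule bilinear_lzero[OF bil])
  ultimately show ?thesis using D(1,2) unfolding majorant_def
    by (cases "proj_plus v x = 0"; cases "proj_minus v x = 0") (fastforce simp: \<open>B 0 0 = 0\<close>)+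
qed

text \<open>Pairing \<open>x\<close> with the difference of its two projections gives the majorant
  at \<open>x\<close>. This yields nondegeneracy on the whole real space, whereas
  \<open>even_lattice\<close> tests only lattice vectors.\<close>

lemma Grassmannian_nondegenerate:
  assumes bil: "bilinear B" and sym: "\<And>x y. B x y = B y x" and v: "v \<in> Grassmannian B"
    and "\<And>y. B x y = 0"
  shows "x = 0"
proof (rule ccontr)
  assume "x \<noteq> 0"
  note D = Grassmannian_decompose[OF v, of x]
  have orth: "B (proj_plus v x) (proj_minus v x) = 0"
    using v D(1,2) by (auto simp: Grassmannian_def)
  have "majorant B v x x = B (proj_plus v x + proj_minus v x) (proj_plus v x - proj_minus v x)"
    using orth sym[of "proj_minus v x" "proj_plus v x"]
    by (simp add: majorant_def bilinear_ladd[OF bil] bilinear_rsub[OF bil])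
  hence "majorant B v x x = 0" by (simp add: D(3) assms(4))
  thus False using majorant_pos[OF bil v \<open>x \<noteq> 0\<close>] by simp
qed

section \<open>Lattice cosets and the discriminant group\<close>

lemma elt_set_plus_eq_iff:
  fixes L :: "'a::real_vector set"
  assumes "full_lattice L"
  shows "x +o L = y +o L \<longleftrightarrow> x - y \<in> L"
proof
  note cl = full_lattice_closed[OF assms]
  assume "x +o L = y +o L"
  moreover have "x \<in> x +o L" using cl(1) by (force simp: elt_set_plus_def)
  ultimately show "x - y \<in> L" by (auto simp: elt_set_plus_def)
next
  note cl = full_lattice_closed[OF assms]
  assume xy: "x - y \<in> L"
  have "x +o L = y +o ((x - y) +o L)" by (simp add: set_plus_rearrange2)
  also have "(x - y) +o L = L"
  proof (intro Set.set_eqI iffI)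
    fix z assume "z \<in> (x - y) +o L"
    thus "z \<in> L" using cl(2)[OF xy] by (auto simp: elt_set_plus_def)
  next
    fix z assume "z \<in> L"
    hence "- (x - y) + z \<in> L" using cl(2,3) xy by blast
    thus "z \<in> (x - y) +o L" unfolding elt_set_plus_def
      by (intro CollectI bexI[of _ "- (x - y) + z"]) auto
  qed
  finally show "x +o L = y +o L" .
qed

lemma mem_coset_iff:
  fixes L :: "'a::real_vector set"
  shows "y \<in> x +o L \<longleftrightarrow> y - x \<in> L"
  by (auto simp: elt_set_plus_def intro!: bexI[of _ "y - x"])

lemma coset_plus_lattice:
  fixes L \<Lambda> :: "'a::real_vector set"
  assumes "full_lattice L" "full_lattice \<Lambda>" "\<Lambda> \<subseteq> L"
  shows "(x +o \<Lambda>) + L = x +o L"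
proof -
  have "\<Lambda> + L = L"
  proof
    show "\<Lambda> + L \<subseteq> L" using full_lattice_closed(2)[OF assms(1)] assms(3) by (auto simp: set_plus_def)
    show "L \<subseteq> \<Lambda> + L" using full_lattice_closed(1)[OF assms(2)] by (force simp: set_plus_def)
  qed
  thus ?thesis by (simp add: set_plus_rearrange3)
qed

lemma coset_rep_mem:
  assumes "full_lattice L" "\<gamma> \<in> quot M L"
  shows "coset_rep \<gamma> \<in> \<gamma>" "\<gamma> = coset_rep \<gamma> +o L"
proof -
  obtain x where \<gamma>: "\<gamma> = x +o L" using assms(2) by (auto simp: quot_def)
  have "x \<in> \<gamma>" using full_lattice_closed(1)[OF assms(1)] by (simp add: \<gamma> mem_coset_iff)
  thus *: "coset_rep \<gamma> \<in> \<gamma>" unfolding coset_rep_def by (rule someI)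
  show "\<gamma> = coset_rep \<gamma> +o L"
    using * elt_set_plus_eq_iff[OF assms(1)] full_lattice_closed(3)[OF assms(1), of "coset_rep \<gamma> - x"]
    by (simp add: \<gamma> mem_coset_iff)
qed

lemma dual_lattice_diff:
  assumes "bilinear B" "x \<in> dual_lattice B L" "y \<in> dual_lattice B L"
  shows "x - y \<in> dual_lattice B L"
  using assms(2,3) by (auto simp: dual_lattice_def bilinear_lsub[OF assms(1)])

lemma dual_lattice_add:
  assumes "bilinear B" "x \<in> dual_lattice B L" "y \<in> dual_lattice B L"
  shows "x + y \<in> dual_lattice B L"
  using assms(2,3) by (auto simp: dual_lattice_def bilinear_ladd[OF assms(1)])

lemma even_lattice_subset_dual: "even_lattice B L \<Longrightarrow> L \<subseteq> dual_lattice B L"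
  by (auto simp: even_lattice_def dual_lattice_def)

text \<open>
  A class of the discriminant group has a representative in the fundamental box of a basis, and
  such a representative is determined by its pairings with the basis, which are bounded integers.
\<close>

lemma finite_disc_group:
  assumes E: "even_lattice B L" and nondeg: "\<And>x. (\<And>y. B x y = 0) \<Longrightarrow> x = 0"
  shows "finite (disc_group B L)"
proof -
  have fl: "full_lattice L" and bil: "bilinear B" using E by (auto simp: even_lattice_def)
  obtain b where b: "finite b" "independent b" "span b = UNIV"
    and L_eq: "L = {\<Sum>x\<in>b. of_int (c x) *\<^sub>R x | c. True}"
    using fl unfolding full_lattice_def by blast
  have bL: "i \<in> L" if "i \<in> b" for i
  proof -
    have "(\<Sum>x\<in>b. of_int (if x = i then 1 else 0) *\<^sub>R x) = (\<Sum>x\<in>b. if x = i then x else 0)"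
      by (intro sum.cong) auto
    also have "\<dots> = i" using b(1) that by simp
    finally show ?thesis unfolding L_eq by (intro CollectI exI[of _ "\<lambda>x. if x = i then 1 else 0"]) simp
  qed
  define M where "M j = (\<Sum>i\<in>b. \<bar>B i j\<bar>)" for j
  define R where "R = {x \<in> dual_lattice B L. \<forall>j\<in>b. \<bar>B x j\<bar> \<le> M j}"
  \<comment> \<open>The pairings with \<open>b\<close> are integral on \<open>R\<close>, so the
    floor only changes their type and loses nothing.\<close>
  define f where "f x = restrict (\<lambda>j. \<lfloor>B x j\<rfloor>) b" for x
  have "inj_on f R"
  proof (rule inj_onI)
    fix x y assume xy: "x \<in> R" "y \<in> R" "f x = f y"
    have "B (x - y) j = 0" if j: "j \<in> b" for j
    proof -
      have "B x j \<in> \<int>" "B y j \<in> \<int>" using xy j bL by (auto simp: R_def dual_lattice_def)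
      moreover have "\<lfloor>B x j\<rfloor> = \<lfloor>B y j\<rfloor>" using fun_cong[OF xy(3), of j] j by (simp add: f_def)
      ultimately have "B x j = B y j" by (metis Ints_cases floor_of_int)
      thus ?thesis by (simp add: bilinear_lsub[OF bil])
    qed
    hence "B (x - y) z = 0" for z
      using bilinear_eq_0_on_span_right[OF bil, of b "x - y" z] b(3) by auto
    thus "x = y" using nondeg[of "x - y"] by simp
  qed
  moreover have "f ` R \<subseteq> PiE b (\<lambda>j. {\<lfloor>- M j\<rfloor>..\<lfloor>M j\<rfloor>})"
    by (auto simp: f_def R_def abs_le_iff intro!: floor_mono) (smt (verit))
  moreover have "finite (PiE b (\<lambda>j. {\<lfloor>- M j\<rfloor>..\<lfloor>M j\<rfloor>}))" using b(1) by (simp add: finite_PiE)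
  ultimately have "finite R" by (metis finite_imageD finite_subset)
  moreover have "disc_group B L \<subseteq> (\<lambda>x. x +o L) ` R"
  proof
    fix \<gamma> assume "\<gamma> \<in> disc_group B L"
    then obtain x where x: "x \<in> dual_lattice B L" "\<gamma> = x +o L" by (auto simp: disc_group_def quot_def)
    define e where "e = representation b x"
    have xe: "x = (\<Sum>i\<in>b. e i *\<^sub>R i)"
      unfolding e_def using b by (subst real_vector.sum_representation_eq) auto
    \<comment> \<open>Subtracting \<open>z\<close> stays in the class and leaves coordinates in
      [0,1), whence the bound \<open>M j\<close>.\<close>
    define z where "z = (\<Sum>i\<in>b. of_int \<lfloor>e i\<rfloor> *\<^sub>R i)"
    have z: "z \<in> L" unfolding L_eq z_def by (intro CollectI exI[of _ "\<lambda>i. \<lfloor>e i\<rfloor>"]) simp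
    have "x - (x - z) \<in> L" using z by simp
    hence "\<gamma> = (x - z) +o L" unfolding x(2) by (simp only: elt_set_plus_eq_iff[OF fl])
    moreover have "x - z \<in> R"
    proof -
      have "x - z \<in> dual_lattice B L"
        using dual_lattice_diff[OF bil x(1)] z even_lattice_subset_dual[OF E] by blast
      moreover have "\<bar>B (x - z) j\<bar> \<le> M j" if "j \<in> b" for j
      proof -
        have "x - z = (\<Sum>i\<in>b. frac (e i) *\<^sub>R i)"
          by (simp add: z_def frac_def scaleR_left_diff_distrib sum_subtractf flip: xe)
        moreover have "linear (\<lambda>x. B x j)" using bil by (simp add: bilinear_def)
        ultimately have "B (x - z) j = (\<Sum>i\<in>b. frac (e i) * B i j)"
          using linear_sum[of "\<lambda>x. B x j" "\<lambda>i. frac (e i) *\<^sub>R i" b]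
          by (simp add: bilinear_lmul[OF bil])
        hence "\<bar>B (x - z) j\<bar> \<le> (\<Sum>i\<in>b. \<bar>frac (e i) * B i j\<bar>)" by simp
        also have "\<dots> \<le> M j" unfolding M_def
          by (intro sum_mono) (simp add: abs_mult mult_left_le_one_le less_imp_le[OF frac_lt_1])
        finally show ?thesis .
      qed
      ultimately show ?thesis by (simp add: R_def)
    qed
    ultimately show "\<gamma> \<in> (\<lambda>x. x +o L) ` R" by blast
  qed
  ultimately show ?thesis by (metis finite_imageI finite_subset)
qed

section \<open>Components of theta functions\<close>

text \<open>The Gaussian factor as a function of the already shifted vector, so that characteristics
  act only by translation and by a character.\<close>

definition theta_term ::
  "('a::real_vector \<Rightarrow> 'a \<Rightarrow> real) \<Rightarrow> complex \<Rightarrow> 'a \<times> 'a \<Rightarrow> 'a set \<times> 'a set \<Rightarrow> 'a \<Rightarrow> complex" where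
  "theta_term B \<tau> \<zeta> v x =
     ee (\<tau> * of_real (B (proj_plus v x) (proj_plus v x) / 2)
         + cnj \<tau> * of_real (B (proj_minus v x) (proj_minus v x) / 2)
         + pair_complex B x \<zeta>)"

lemma norm_ee: "norm (ee w) = exp (- 2 * pi * Im w)"
  by (simp add: ee_def norm_exp_eq_Re)

text \<open>The imaginary parts of \<tau> and its conjugate have opposite signs, which turns
  \<open>B\<close> into its majorant in the norm of a term; the imaginary part of \<zeta>
  contributes the linear exponent \<open>l\<close>.\<close>

lemma summable_on_theta_term:
  assumes L: "full_lattice L" and bil: "bilinear B" and sym: "\<And>x y. B x y = B y x"
    and \<tau>: "\<tau> \<in> uhp" and v: "v \<in> Grassmannian B"
  shows "theta_term B \<tau> \<zeta> v summable_on (x0 +o L)"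
proof -
  define l where "l x = - 2 * pi * B x (snd \<zeta>)" for x
  have "linear l"
    by (intro linearI) (simp_all add: l_def bilinear_ladd[OF bil] bilinear_lmul[OF bil] algebra_simps)
  moreover have "majorant B v x y = majorant B v y x" for x y
    by (simp add: majorant_def sym)
  moreover have "pi * Im \<tau> > 0" using \<tau> by (simp add: uhp_def)
  ultimately have summ: "(\<lambda>x. exp (l x - pi * Im \<tau> * majorant B v x x)) summable_on (x0 +o L)"
    using majorant_pos[OF bil v]
    by (intro summable_on_gaussian_translate bilinear_majorant bil v L) auto
  have "norm (theta_term B \<tau> \<zeta> v x) = exp (l x - pi * Im \<tau> * majorant B v x x)" for x
    by (simp add: theta_term_def norm_ee pair_complex_def l_def majorant_def algebra_simps)
  thus ?thesis using summ by (simp add: abs_summable_summable[of "theta_term B \<tau> \<zeta> v"])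
qed

text \<open>By symmetry of \<open>B\<close> the normalising factor completes the half shift in the
  character, so Gaussian and character are both evaluated at \<open>x + \<beta>\<close>.\<close>

lemma hat_Theta_eq:
  assumes bil: "bilinear B" and sym: "\<And>x y. B x y = B y x"
  shows "hat_Theta B L \<tau> \<zeta> \<alpha> \<beta> v \<gamma> =
    (\<Sum>\<^sub>\<infinity>x\<in>dual_lattice B L. theta_term B \<tau> \<zeta> v (x + \<beta>) * ee (- of_real (B (x + \<beta>) \<alpha>)) * basis_vec (x +o L) \<gamma>)"
  unfolding hat_Theta_def Theta_def infsum_cmult_right'[symmetric]
proof (rule infsum_cong)
  fix x
  have *: "- of_real (B (x + \<beta>) \<alpha>) = - of_real (B \<alpha> \<beta> / 2) - (of_real (B (x + (1 / 2) *\<^sub>R \<beta>) \<alpha>) :: complex)"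
    by (simp add: bilinear_ladd[OF bil] bilinear_lmul[OF bil] sym[of \<alpha> \<beta>] field_simps)
  show "ee (- of_real (B \<alpha> \<beta> / 2)) *
       (ee (\<tau> * of_real (B (proj_plus v (x + \<beta>)) (proj_plus v (x + \<beta>)) / 2) +
            cnj \<tau> * of_real (B (proj_minus v (x + \<beta>)) (proj_minus v (x + \<beta>)) / 2) +
            pair_complex B (x + \<beta>) \<zeta> - of_real (B (x + (1 / 2) *\<^sub>R \<beta>) \<alpha>)) *
        basis_vec (x +o L) \<gamma>) =
       theta_term B \<tau> \<zeta> v (x + \<beta>) * ee (- of_real (B (x + \<beta>) \<alpha>)) * basis_vec (x +o L) \<gamma>"
    unfolding * theta_term_def diff_conv_add_uminus ee_add by (simp only: mult_ac)
qed

text \<open>Elements of the group algebra are functions on all sets, so identities between them must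
  also be compared off the discriminant group.\<close>

lemma hat_Theta_outside:
  assumes "\<gamma> \<notin> disc_group B L"
  shows "hat_Theta B L \<tau> \<zeta> \<alpha> \<beta> v \<gamma> = 0"
proof -
  have "basis_vec (x +o L) \<gamma> = 0" if "x \<in> dual_lattice B L" for x
    using that assms by (auto simp: basis_vec_def disc_group_def quot_def)
  hence "Theta B L \<tau> \<zeta> \<alpha> \<beta> v \<gamma> = 0"
    unfolding Theta_def by (intro infsum_0) simp
  thus ?thesis by (simp add: hat_Theta_def)
qed

text \<open>The character \<open>x \<mapsto> \<^bold>e(-(x, \<alpha>))\<close> is constant on cosets of \<open>L\<close>, so it leaves the sum.\<close>

lemma hat_Theta_coset:
  assumes E: "even_lattice B L" and x0: "x0 \<in> dual_lattice B L" and \<alpha>: "\<alpha> \<in> dual_lattice B L"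
  shows "hat_Theta B L \<tau> \<zeta> \<alpha> \<beta> v (x0 +o L) =
    ee (- of_real (B (x0 + \<beta>) \<alpha>)) * (\<Sum>\<^sub>\<infinity>x\<in>(x0 + \<beta>) +o L. theta_term B \<tau> \<zeta> v x)"
proof -
  have fl: "full_lattice L" and bil: "bilinear B" and sym: "\<And>x y. B x y = B y x"
    using E by (auto simp: even_lattice_def)
  have "hat_Theta B L \<tau> \<zeta> \<alpha> \<beta> v (x0 +o L) =
    (\<Sum>\<^sub>\<infinity>x\<in>x0 +o L. ee (- of_real (B (x0 + \<beta>) \<alpha>)) * theta_term B \<tau> \<zeta> v (x + \<beta>))"
    unfolding hat_Theta_eq[OF bil sym]
  \<comment> \<open>The basis vector selects one coset from the dual lattice. That coset lies inside
    the dual lattice, so the first case is contradictory.\<close>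
  proof (rule infsum_cong_neutral)
    fix x assume "x \<in> x0 +o L - dual_lattice B L"
    hence "x - x0 \<in> dual_lattice B L" "x \<notin> dual_lattice B L"
      using even_lattice_subset_dual[OF E] by (auto simp: mem_coset_iff)
    thus "ee (- of_real (B (x0 + \<beta>) \<alpha>)) * theta_term B \<tau> \<zeta> v (x + \<beta>) = 0"
      using dual_lattice_add[OF bil x0, of "x - x0"] by simp
  next
    fix x assume "x \<in> dual_lattice B L - x0 +o L"
    hence "x +o L \<noteq> x0 +o L" by (auto simp: elt_set_plus_eq_iff[OF fl] mem_coset_iff)
    thus "theta_term B \<tau> \<zeta> v (x + \<beta>) * ee (- of_real (B (x + \<beta>) \<alpha>)) * basis_vec (x +o L) (x0 +o L) = 0"
      by (simp add: basis_vec_def)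
  next
    fix x assume "x \<in> dual_lattice B L \<inter> (x0 +o L)"
    hence x: "x - x0 \<in> L" by (simp add: mem_coset_iff)
    hence "x0 +o L = x +o L" using elt_set_plus_eq_iff[OF fl, of x x0] by simp
    moreover have "ee (- of_real (B (x + \<beta>) \<alpha>)) = ee (- of_real (B (x0 + \<beta>) \<alpha>))"
    proof -
      have "B (x - x0) \<alpha> \<in> \<int>" using x \<alpha> by (simp add: dual_lattice_def sym[of _ \<alpha>])
      hence "ee (of_real (- B (x - x0) \<alpha>)) = 1" by (intro ee_Ints) simp
      moreover have "- of_real (B (x + \<beta>) \<alpha>) =
          of_real (- B (x - x0) \<alpha>) + (- of_real (B (x0 + \<beta>) \<alpha>) :: complex)"
        by (simp add: bilinear_ladd[OF bil] bilinear_lsub[OF bil])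
      ultimately show ?thesis by (simp only: ee_add mult_1)
    qed
    ultimately show "theta_term B \<tau> \<zeta> v (x + \<beta>) * ee (- of_real (B (x + \<beta>) \<alpha>)) * basis_vec (x +o L) (x0 +o L) =
      ee (- of_real (B (x0 + \<beta>) \<alpha>)) * theta_term B \<tau> \<zeta> v (x + \<beta>)"
      by (simp add: basis_vec_def)
  qed
  also have "\<dots> = ee (- of_real (B (x0 + \<beta>) \<alpha>)) * (\<Sum>\<^sub>\<infinity>x\<in>x0 +o L. theta_term B \<tau> \<zeta> v (x + \<beta>))"
    by (rule infsum_cmult_right')
  also have "(\<Sum>\<^sub>\<infinity>x\<in>x0 +o L. theta_term B \<tau> \<zeta> v (x + \<beta>)) = (\<Sum>\<^sub>\<infinity>x\<in>(x0 + \<beta>) +o L. theta_term B \<tau> \<zeta> v x)"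
    by (rule infsum_reindex_bij_witness[of _ "\<lambda>x. x - \<beta>" "\<lambda>x. x + \<beta>"])
       (auto simp: mem_coset_iff algebra_simps)
  finally show ?thesis .
qed

lemma hat_Theta_0: "bilinear B \<Longrightarrow> hat_Theta B L \<tau> \<zeta> 0 0 v = Theta B L \<tau> \<zeta> 0 0 v"
  by (simp add: hat_Theta_def bilinear_lzero ee_def)

lemma Theta_coset:
  assumes E: "even_lattice B L" and x0: "x0 \<in> dual_lattice B L"
  shows "Theta B L \<tau> \<zeta> 0 0 v (x0 +o L) = (\<Sum>\<^sub>\<infinity>x\<in>x0 +o L. theta_term B \<tau> \<zeta> v x)"
proof -
  have bil: "bilinear B" using E by (simp add: even_lattice_def)
  have "0 \<in> dual_lattice B L" by (simp add: dual_lattice_def bilinear_lzero[OF bil])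
  from hat_Theta_coset[OF E x0 this, of \<tau> \<zeta> 0 v] show ?thesis
    by (simp add: hat_Theta_0[OF bil] bilinear_rzero[OF bil] ee_def)
qed

section \<open>Over-lattices\<close>

lemma coset_rep_quot:
  assumes L: "full_lattice L" and \<Lambda>: "full_lattice \<Lambda>" and sub: "\<Lambda> \<subseteq> L" and \<alpha>: "\<alpha> \<in> quot L \<Lambda>"
  shows "coset_rep \<alpha> \<in> L"
proof -
  obtain y where y: "y \<in> L" "\<alpha> = y +o \<Lambda>" using \<alpha> by (auto simp: quot_def)
  hence "coset_rep \<alpha> - y \<in> L" using coset_rep_mem(1)[OF \<Lambda> \<alpha>] sub by (auto simp: mem_coset_iff)
  thus ?thesis using full_lattice_closed(2)[OF L y(1)] by fastforce
qed

text \<open>\<open>x0 +o L\<close> is the disjoint union of finitely many translates of \<Lambda>;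
  summability on each piece is what makes \<open>infsum\<close> additive.\<close>

lemma infsum_coset_split:
  fixes f :: "'a::real_vector \<Rightarrow> complex"
  assumes L: "full_lattice L" and \<Lambda>: "full_lattice \<Lambda>" and sub: "\<Lambda> \<subseteq> L" and fin: "finite (quot L \<Lambda>)"
    and summ: "\<And>x. f summable_on (x +o \<Lambda>)"
  shows "(\<Sum>\<beta>\<in>quot L \<Lambda>. \<Sum>\<^sub>\<infinity>x\<in>(x0 + coset_rep \<beta>) +o \<Lambda>. f x) = (\<Sum>\<^sub>\<infinity>x\<in>x0 +o L. f x)"
proof -
  note clL = full_lattice_closed[OF L] and cl\<Lambda> = full_lattice_closed[OF \<Lambda>]
  have rep: "(x0 + coset_rep \<beta>) +o \<Lambda> = x0 +o \<beta>" if "\<beta> \<in> quot L \<Lambda>" for \<beta>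
    using coset_rep_mem(2)[OF \<Lambda> that] by (metis set_plus_rearrange2)
  have "(\<Sum>\<beta>\<in>quot L \<Lambda>. \<Sum>\<^sub>\<infinity>x\<in>(x0 + coset_rep \<beta>) +o \<Lambda>. f x) = (\<Sum>\<beta>\<in>quot L \<Lambda>. \<Sum>\<^sub>\<infinity>x\<in>x0 +o \<beta>. f x)"
    by (simp add: rep)
  also have "\<dots> = (\<Sum>\<^sub>\<infinity>x\<in>(\<Union>\<beta>\<in>quot L \<Lambda>. x0 +o \<beta>). f x)"
  proof (rule sum_infsum[OF fin])
    fix \<beta> assume "\<beta> \<in> quot L \<Lambda>"
    thus "f summable_on (x0 +o \<beta>)" using summ rep by metis
  next
    fix \<beta> \<beta>' assume "\<beta> \<in> quot L \<Lambda>" "\<beta>' \<in> quot L \<Lambda>" "\<beta> \<noteq> \<beta>'"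
    moreover from this obtain x y where "\<beta> = x +o \<Lambda>" "\<beta>' = y +o \<Lambda>" by (auto simp: quot_def)
    ultimately have xy: "\<beta> = x +o \<Lambda>" "\<beta>' = y +o \<Lambda>" "x - y \<notin> \<Lambda>" by (auto simp: elt_set_plus_eq_iff[OF \<Lambda>])
    have False if "z - x0 \<in> \<beta>" "z - x0 \<in> \<beta>'" for z
    proof -
      have "z - x0 - y \<in> \<Lambda>" "z - x0 - x \<in> \<Lambda>" using that by (simp_all add: xy mem_coset_iff)
      hence "(z - x0 - y) + - (z - x0 - x) \<in> \<Lambda>" using cl\<Lambda>(2,3) by blast
      thus False using xy(3) by simp
    qed
    thus "(x0 +o \<beta>) \<inter> (x0 +o \<beta>') = {}" by (auto simp: mem_coset_iff)
  qed
  also have "(\<Union>\<beta>\<in>quot L \<Lambda>. x0 +o \<beta>) = x0 +o L"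
  proof (intro Set.set_eqI iffI)
    fix z assume "z \<in> (\<Union>\<beta>\<in>quot L \<Lambda>. x0 +o \<beta>)"
    then obtain x where "x \<in> L" "z - x0 - x \<in> L" using sub by (auto simp: quot_def mem_coset_iff)
    thus "z \<in> x0 +o L" using clL(2)[of x "z - x0 - x"] by (simp add: mem_coset_iff)
  next
    fix z assume "z \<in> x0 +o L"
    hence "z - x0 \<in> L" by (simp add: mem_coset_iff)
    moreover have "z \<in> x0 +o ((z - x0) +o \<Lambda>)" using cl\<Lambda>(1) by (simp add: mem_coset_iff)
    ultimately show "z \<in> (\<Union>\<beta>\<in>quot L \<Lambda>. x0 +o \<beta>)" by (auto simp: quot_def)
  qed
  finally show ?thesis .
qed

text \<open>Orthogonality of characters on L/\<Lambda>. If \<open>x\<close> pairs non-integrally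
  with some \<open>a\<close> in \<open>L\<close>, translating by \<open>a\<close> permutes the
  classes but multiplies the sum by a number other than 1, so the sum vanishes.\<close>

lemma sum_characters:
  assumes bil: "bilinear B" and L: "full_lattice L" and \<Lambda>: "full_lattice \<Lambda>" and sub: "\<Lambda> \<subseteq> L"
    and x: "x \<in> dual_lattice B \<Lambda>"
  shows "(\<Sum>\<alpha>\<in>quot L \<Lambda>. ee (- of_real (B x (coset_rep \<alpha>)))) =
    (if x \<in> dual_lattice B L then of_nat (card (quot L \<Lambda>)) else 0)"
proof -
  note clL = full_lattice_closed[OF L]
  note rep = coset_rep_quot[OF L \<Lambda> sub]
  show ?thesis
  proof (cases "x \<in> dual_lattice B L")
    case True
    have "ee (- of_real (B x (coset_rep \<alpha>))) = 1" if "\<alpha> \<in> quot L \<Lambda>" for \<alpha>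
      using True rep[OF that] ee_Ints[of "- B x (coset_rep \<alpha>)"] by (auto simp: dual_lattice_def)
    thus ?thesis using True by simp
  next
    case False
    then obtain a where a: "a \<in> L" "B x a \<notin> \<int>" by (auto simp: dual_lattice_def)
    define chi where "chi \<alpha> = ee (- of_real (B x (coset_rep \<alpha>)))" for \<alpha>
    have shift: "a' +o \<alpha> \<in> quot L \<Lambda>" if "a' \<in> L" "\<alpha> \<in> quot L \<Lambda>" for a' \<alpha>
      using that clL(2) by (auto simp: quot_def set_plus_rearrange2)
    have inv: "- a +o (a +o \<alpha>) = \<alpha>" "a +o (- a +o \<alpha>) = \<alpha>" for \<alpha>
      by (simp_all add: set_plus_rearrange2)
    \<comment> \<open>The chosen representative of the translated class differs from the translated
      representative by some \<mu> in \<Lambda>, which pairs integrally with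
      \<open>x\<close>.\<close>
    have chi_shift: "chi (a +o \<alpha>) = ee (- of_real (B x a)) * chi \<alpha>" if "\<alpha> \<in> quot L \<Lambda>" for \<alpha>
    proof -
      have "coset_rep (a +o \<alpha>) \<in> a +o (coset_rep \<alpha> +o \<Lambda>)"
        using coset_rep_mem(1)[OF \<Lambda> shift[OF a(1) that]] coset_rep_mem(2)[OF \<Lambda> that] by simp
      then obtain \<mu> where \<mu>: "\<mu> \<in> \<Lambda>" "coset_rep (a +o \<alpha>) = a + (coset_rep \<alpha> + \<mu>)"
        by (auto simp: elt_set_plus_def)
      have "ee (of_real (- B x \<mu>)) = 1" using x \<mu>(1) by (intro ee_Ints) (simp add: dual_lattice_def)
      moreover have "- of_real (B x (coset_rep (a +o \<alpha>))) =
          of_real (- B x \<mu>) + (- of_real (B x a) + - of_real (B x (coset_rep \<alpha>)) :: complex)"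
        by (simp add: \<mu>(2) bilinear_radd[OF bil])
      ultimately show ?thesis unfolding chi_def by (simp only: ee_add mult_1)
    qed
    have "(\<Sum>\<alpha>\<in>quot L \<Lambda>. chi \<alpha>) = (\<Sum>\<alpha>\<in>quot L \<Lambda>. chi (a +o \<alpha>))"
      by (rule sum.reindex_bij_witness[of _ "\<lambda>\<alpha>. a +o \<alpha>" "\<lambda>\<alpha>. - a +o \<alpha>"])
         (auto simp: inv intro!: shift a clL(3))
    also have "\<dots> = ee (- of_real (B x a)) * (\<Sum>\<alpha>\<in>quot L \<Lambda>. chi \<alpha>)"
      by (simp add: chi_shift sum_distrib_left)
    finally have "(1 - ee (- of_real (B x a))) * (\<Sum>\<alpha>\<in>quot L \<Lambda>. chi \<alpha>) = 0"
      by (simp add: left_diff_distrib)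
    moreover have "ee (- of_real (B x a)) \<noteq> 1"
    proof
      assume "ee (- of_real (B x a)) = 1"
      then obtain n :: int where "2 * pi * - B x a = of_int (2 * n) * pi"
        unfolding ee_def exp_eq_1 by auto
      hence "pi * B x a = pi * of_int (- n)" by (simp add: algebra_simps)
      hence "B x a = of_int (- n)" by (simp only: mult_cancel_left) simp
      thus False using a(2) by (metis Ints_of_int)
    qed
    ultimately show ?thesis using False by (simp add: chi_def)
  qed
qed

text \<open>Each class \<delta> of \<open>L^*\<close>/\<Lambda> lies over the single class
  \<open>\<delta> + L\<close>, so the double sum collapses. Finiteness passes along this surjection,
  which keeps the sums from defaulting to 0.\<close>

lemma arrow_up_apply:
  assumes L: "full_lattice L" and \<Lambda>: "full_lattice \<Lambda>" and sub: "\<Lambda> \<subseteq> L"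
    and fin: "finite (disc_group B \<Lambda>)"
  shows "arrow_up B L \<Lambda> U \<delta> = (if \<delta> \<in> quot (dual_lattice B L) \<Lambda> then U (\<delta> + L) else 0)"
    "finite (disc_group B L)"
    "\<And>\<delta>. \<delta> \<in> quot (dual_lattice B L) \<Lambda> \<Longrightarrow> \<delta> + L \<in> disc_group B L"
    "quot (dual_lattice B L) \<Lambda> \<subseteq> disc_group B \<Lambda>"
proof -
  let ?Q = "quot (dual_lattice B L) \<Lambda>"
  show Q: "?Q \<subseteq> disc_group B \<Lambda>"
    using sub by (auto simp: disc_group_def quot_def dual_lattice_def)
  hence finQ: "finite ?Q" using fin by (rule finite_subset)
  have img: "(\<lambda>\<delta>. \<delta> + L) ` ?Q = disc_group B L"
    using coset_plus_lattice[OF L \<Lambda> sub] by (simp add: quot_def disc_group_def image_image)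
  thus mem: "\<delta> + L \<in> disc_group B L" if "\<delta> \<in> ?Q" for \<delta> using that by blast
  show fin': "finite (disc_group B L)" using finQ img by (metis finite_imageI)
  have "arrow_up B L \<Lambda> U \<delta> = (\<Sum>\<gamma>\<in>disc_group B L. U \<gamma> * (if \<delta> \<in> ?Q \<and> \<delta> + L = \<gamma> then 1 else 0))"
    unfolding arrow_up_def basis_vec_def using finQ by (intro sum.cong refl arg_cong2[where f = "(*)"]) simp
  also have "\<dots> = (\<Sum>\<gamma>\<in>disc_group B L. if \<gamma> = \<delta> + L then (if \<delta> \<in> ?Q then U \<gamma> else 0) else 0)"
    by (intro sum.cong) auto
  also have "\<dots> = (if \<delta> \<in> ?Q then U (\<delta> + L) else 0)" using mem fin' by simp
  finally show "arrow_up B L \<Lambda> U \<delta> = (if \<delta> \<in> ?Q then U (\<delta> + L) else 0)" .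
qed

lemma dual_lattice_neg_form [simp]: "dual_lattice (neg_form B) L = dual_lattice B L"
  by (simp add: dual_lattice_def neg_form_def)

lemma disc_group_neg_form [simp]: "disc_group (neg_form B) L = disc_group B L"
  by (simp add: disc_group_def)

text \<open>Both pairings reduce to the sum of \<open>U (\<delta> + L) * V \<delta>\<close> over the
  classes \<delta> of \<open>L^*\<close>/\<Lambda>.\<close>

lemma arrow_adjoint:
  assumes L: "full_lattice L" and \<Lambda>: "full_lattice \<Lambda>" and sub: "\<Lambda> \<subseteq> L"
    and fin: "finite (disc_group B \<Lambda>)"
  shows "disc_pairing (disc_group B L) U (arrow_down (neg_form B) L \<Lambda> V) =
    disc_pairing (disc_group B \<Lambda>) (arrow_up B L \<Lambda> U) V"
proof -
  note up = arrow_up_apply[OF L \<Lambda> sub fin]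
  let ?Q = "quot (dual_lattice B L) \<Lambda>"
  have "disc_pairing (disc_group B L) U (arrow_down (neg_form B) L \<Lambda> V) =
      (\<Sum>\<delta>\<in>disc_group B \<Lambda>. \<Sum>\<gamma>\<in>disc_group B L. if \<gamma> = \<delta> + L then (if \<delta> \<in> ?Q then U \<gamma> * V \<delta> else 0) else 0)"
    unfolding disc_pairing_def arrow_down_def sum_distrib_left
    by (subst sum.swap) (auto intro!: sum.cong simp: basis_vec_def)
  also have "\<dots> = disc_pairing (disc_group B \<Lambda>) (arrow_up B L \<Lambda> U) V"
    unfolding disc_pairing_def up(1) using up(2,3) by (intro sum.cong) auto
  finally show ?thesis .
qed

lemma arrow_up_Theta:
  assumes EL: "even_lattice B L" and E\<Lambda>: "even_lattice B \<Lambda>" and sub: "\<Lambda> \<subseteq> L"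
    and fin: "finite (quot L \<Lambda>)" and \<tau>: "\<tau> \<in> uhp" and v: "v \<in> Grassmannian B"
  shows "arrow_up B L \<Lambda> (Theta B L \<tau> \<zeta> 0 0 v) \<delta> = 1 / of_nat (card (quot L \<Lambda>)) *
    (\<Sum>\<alpha>\<in>quot L \<Lambda>. \<Sum>\<beta>\<in>quot L \<Lambda>. hat_Theta_class B \<Lambda> \<tau> \<zeta> \<alpha> \<beta> v \<delta>)"
proof -
  have L: "full_lattice L" and \<Lambda>: "full_lattice \<Lambda>" and bil: "bilinear B" and sym: "\<And>x y. B x y = B y x"
    and int: "\<And>x y. x \<in> L \<Longrightarrow> y \<in> L \<Longrightarrow> B x y \<in> \<int>"
    using EL E\<Lambda> by (auto simp: even_lattice_def)
  have find: "finite (disc_group B \<Lambda>)"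
    using finite_disc_group[OF E\<Lambda>] Grassmannian_nondegenerate[OF bil sym v] by blast
  note up = arrow_up_apply[OF L \<Lambda> sub find]
  note clL = full_lattice_closed[OF L]
  note rep = coset_rep_quot[OF L \<Lambda> sub]
  let ?c = "of_nat (card (quot L \<Lambda>)) :: complex"
  \<comment> \<open>The zero class shows that |H| is nonzero, so dividing by it is
    meaningful.\<close>
  have "\<Lambda> \<in> quot L \<Lambda>" unfolding quot_def using clL(1) by (intro image_eqI[of _ _ 0]) simp_all
  hence c: "?c \<noteq> 0" using fin by (metis card_0_eq empty_iff of_nat_eq_0_iff)
  show ?thesis
  proof (cases "\<delta> \<in> disc_group B \<Lambda>")
    case False
    hence "\<delta> \<notin> quot (dual_lattice B L) \<Lambda>" using up(4) by blast
    thus ?thesis unfolding up(1) hat_Theta_class_def hat_Theta_outside[OF False] by simp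
  next
    case True
    then obtain x where x: "x \<in> dual_lattice B \<Lambda>" and \<delta>: "\<delta> = x +o \<Lambda>"
      by (auto simp: disc_group_def quot_def)
    let ?S = "\<Sum>\<^sub>\<infinity>y\<in>x +o L. theta_term B \<tau> \<zeta> v y"
    \<comment> \<open>The cross term between the representatives of \<alpha> and \<beta> is
      integral, both lying in \<open>L\<close>; hence the summand is a function of \<alpha> times a
      function of \<beta> and the double sum factors.\<close>
    have "hat_Theta_class B \<Lambda> \<tau> \<zeta> \<alpha> \<beta> v \<delta> = ee (- of_real (B x (coset_rep \<alpha>))) *
        (\<Sum>\<^sub>\<infinity>y\<in>(x + coset_rep \<beta>) +o \<Lambda>. theta_term B \<tau> \<zeta> v y)"
      if \<alpha>\<beta>: "\<alpha> \<in> quot L \<Lambda>" "\<beta> \<in> quot L \<Lambda>" for \<alpha> \<beta>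
    proof -
      have "coset_rep \<alpha> \<in> dual_lattice B \<Lambda>"
        using rep[OF \<alpha>\<beta>(1)] int sub unfolding dual_lattice_def by blast
      moreover have "ee (of_real (- B (coset_rep \<beta>) (coset_rep \<alpha>))) = 1"
        using int rep \<alpha>\<beta> by (intro ee_Ints) simp
      moreover have "- of_real (B (x + coset_rep \<beta>) (coset_rep \<alpha>)) =
          - of_real (B x (coset_rep \<alpha>)) + (of_real (- B (coset_rep \<beta>) (coset_rep \<alpha>)) :: complex)"
        by (simp add: bilinear_ladd[OF bil])
      ultimately show ?thesis
        unfolding hat_Theta_class_def \<delta> using hat_Theta_coset[OF E\<Lambda> x]
        by (simp only: ee_add mult_1_right)
    qed
    hence "(\<Sum>\<alpha>\<in>quot L \<Lambda>. \<Sum>\<beta>\<in>quot L \<Lambda>. hat_Theta_class B \<Lambda> \<tau> \<zeta> \<alpha> \<beta> v \<delta>) =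
        (\<Sum>\<alpha>\<in>quot L \<Lambda>. ee (- of_real (B x (coset_rep \<alpha>)))) *
        (\<Sum>\<beta>\<in>quot L \<Lambda>. \<Sum>\<^sub>\<infinity>y\<in>(x + coset_rep \<beta>) +o \<Lambda>. theta_term B \<tau> \<zeta> v y)"
      by (simp add: sum_product)
    also have "\<dots> = (if x \<in> dual_lattice B L then ?c else 0) * ?S"
      using sum_characters[OF bil L \<Lambda> sub x]
        infsum_coset_split[OF L \<Lambda> sub fin summable_on_theta_term[OF \<Lambda> bil sym \<tau> v]]
      by (simp only:)
    finally have rhs: "(\<Sum>\<alpha>\<in>quot L \<Lambda>. \<Sum>\<beta>\<in>quot L \<Lambda>. hat_Theta_class B \<Lambda> \<tau> \<zeta> \<alpha> \<beta> v \<delta>) =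
      (if x \<in> dual_lattice B L then ?c else 0) * ?S" .
    \<comment> \<open>Membership in \<open>L^*\<close> does not depend on the representative, as
      \<Lambda> is contained in \<open>L\<close> and so in \<open>L^*\<close>.\<close>
    have "\<delta> \<in> quot (dual_lattice B L) \<Lambda> \<longleftrightarrow> x \<in> dual_lattice B L"
    proof
      assume "\<delta> \<in> quot (dual_lattice B L) \<Lambda>"
      then obtain y where y: "y \<in> dual_lattice B L" "x +o \<Lambda> = y +o \<Lambda>" by (auto simp: quot_def \<delta>)
      hence "x - y \<in> \<Lambda>" using elt_set_plus_eq_iff[OF \<Lambda>] by blast
      hence "x - y \<in> dual_lattice B L" using sub even_lattice_subset_dual[OF EL] by blast
      from dual_lattice_add[OF bil this y(1)] show "x \<in> dual_lattice B L" by simp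
    qed (auto simp: quot_def \<delta>)
    moreover have "\<delta> + L = x +o L" unfolding \<delta> by (rule coset_plus_lattice[OF L \<Lambda> sub])
    moreover have "1 / ?c * (?c * ?S) = ?S" using c by simp
    ultimately show ?thesis
      unfolding up(1) rhs by (cases "x \<in> dual_lattice B L") (simp_all only: if_True if_False Theta_coset[OF EL] mult_zero_left mult_zero_right)
  qed
qed

section \<open>The theta function of an over-lattice\<close>

theorem proposition4p4:
  fixes B :: "'a::real_vector \<Rightarrow> 'a \<Rightarrow> real" and L \<Lambda> :: "'a set"
    and \<tau> :: complex and v :: "'a set \<times> 'a set" and \<zeta> :: "'a \<times> 'a"
  assumes "even_lattice B L" and "even_lattice B \<Lambda>" and "\<Lambda> \<subseteq> L" and "finite (quot L \<Lambda>)"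
    and "\<tau> \<in> uhp" and "v \<in> Grassmannian B"
  shows "arrow_up B L \<Lambda> (Theta B L \<tau> \<zeta> 0 0 v) =
           (\<lambda>\<delta>. 1 / of_nat (card (quot L \<Lambda>)) *
              (\<Sum>\<alpha>\<in>quot L \<Lambda>. \<Sum>\<beta>\<in>quot L \<Lambda>. hat_Theta_class B \<Lambda> \<tau> \<zeta> \<alpha> \<beta> v \<delta>)) \<and>
         (\<forall>\<rho> (k::real) (l::real) \<Gamma> (F :: complex \<Rightarrow> 'a set \<Rightarrow> complex).
            weil_representation (neg_form B) \<Lambda> \<rho> \<longrightarrow>
            subgroup \<Gamma> Mp2Z \<longrightarrow> finite (rcosets\<^bsub>Mp2Z\<^esub> \<Gamma>) \<longrightarrow>
            modular_form (disc_group (neg_form B) \<Lambda>) \<rho> k l \<Gamma> F \<longrightarrow>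
            Phi B L v (\<lambda>z. arrow_down (neg_form B) L \<Lambda> (F z)) \<tau> \<zeta> =
              1 / of_nat (card (quot L \<Lambda>)) *
              (\<Sum>\<alpha>\<in>quot L \<Lambda>. \<Sum>\<beta>\<in>quot L \<Lambda>.
                 disc_pairing (disc_group B \<Lambda>) (hat_Theta_class B \<Lambda> \<tau> \<zeta> \<alpha> \<beta> v) (F \<tau>)))"
proof (intro conjI allI impI)
  let ?T = "Theta B L \<tau> \<zeta> 0 0 v" and ?H = "\<lambda>\<alpha> \<beta>. hat_Theta_class B \<Lambda> \<tau> \<zeta> \<alpha> \<beta> v"
  have up: "arrow_up B L \<Lambda> ?T = (\<lambda>\<delta>. 1 / of_nat (card (quot L \<Lambda>)) *
      (\<Sum>\<alpha>\<in>quot L \<Lambda>. \<Sum>\<beta>\<in>quot L \<Lambda>. ?H \<alpha> \<beta> \<delta>))"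
    using arrow_up_Theta[OF assms] by blast
  show "arrow_up B L \<Lambda> ?T = (\<lambda>\<delta>. 1 / of_nat (card (quot L \<Lambda>)) *
      (\<Sum>\<alpha>\<in>quot L \<Lambda>. \<Sum>\<beta>\<in>quot L \<Lambda>. ?H \<alpha> \<beta> \<delta>))"
    by (rule up)
  fix F :: "complex \<Rightarrow> 'a set \<Rightarrow> complex"
  have L: "full_lattice L" and \<Lambda>: "full_lattice \<Lambda>" and bil: "bilinear B" and sym: "\<And>x y. B x y = B y x"
    using assms(1,2) by (auto simp: even_lattice_def)
  have fin: "finite (disc_group B \<Lambda>)"
    using finite_disc_group[OF assms(2)] Grassmannian_nondegenerate[OF bil sym assms(6)] by blast
  \<comment> \<open>Adjointness moves the arrow from \<open>F\<close> to the theta function, where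
    the first identity applies.\<close>
  have "Phi B L v (\<lambda>z. arrow_down (neg_form B) L \<Lambda> (F z)) \<tau> \<zeta> =
      disc_pairing (disc_group B \<Lambda>) (arrow_up B L \<Lambda> ?T) (F \<tau>)"
    unfolding Phi_def by (rule arrow_adjoint[OF L \<Lambda> assms(3) fin])
  also have "\<dots> = 1 / of_nat (card (quot L \<Lambda>)) * (\<Sum>\<gamma>\<in>disc_group B \<Lambda>.
      \<Sum>\<alpha>\<in>quot L \<Lambda>. \<Sum>\<beta>\<in>quot L \<Lambda>. ?H \<alpha> \<beta> \<gamma> * F \<tau> \<gamma>)"
    unfolding up disc_pairing_def by (simp only: sum_distrib_left sum_distrib_right mult.assoc)
  also have "(\<Sum>\<gamma>\<in>disc_group B \<Lambda>. \<Sum>\<alpha>\<in>quot L \<Lambda>. \<Sum>\<beta>\<in>quot L \<Lambda>. ?H \<alpha> \<beta> \<gamma> * F \<tau> \<gamma>) =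
      (\<Sum>\<alpha>\<in>quot L \<Lambda>. \<Sum>\<beta>\<in>quot L \<Lambda>. disc_pairing (disc_group B \<Lambda>) (?H \<alpha> \<beta>) (F \<tau>))"
    unfolding disc_pairing_def
    by (subst sum.swap, rule sum.cong[OF refl], rule sum.swap)
  finally show "Phi B L v (\<lambda>z. arrow_down (neg_form B) L \<Lambda> (F z)) \<tau> \<zeta> =
      1 / of_nat (card (quot L \<Lambda>)) *
      (\<Sum>\<alpha>\<in>quot L \<Lambda>. \<Sum>\<beta>\<in>quot L \<Lambda>. disc_pairing (disc_group B \<Lambda>) (?H \<alpha> \<beta>) (F \<tau>))" .
qed

end
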